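(* For every exponentially concentrated random sofic approximation $\mathbb{P}$ to the free group $\Gamma$ and every finite alphabet $\mathtt{A}$, the typical entropies $h^\sharp$ and $h^\flat$ are isomorphism-invariant: if $\mu,\nu\in\mathrm{Prob}^\Gamma(\mathtt{A}^\Gamma)$ are such that the measure-preserving $\Gamma$-systems $(\mathtt{A}^\Gamma,\mu)$ and $(\mathtt{A}^\Gamma,\nu)$ are measure-theoretically isomorphic, then $h^\sharp(\mu)=h^\sharp(\nu)$ and $h^\flat(\mu)=h^\flat(\nu)$.
   Context: $\Gamma$ is the free group of rank $r$ with free generators $s_1,\dots,s_r$ and identity $e$; $d(\gamma,e)$ is word length. $\Gamma$ acts on $\mathtt{A}^\Gamma$ by $(g\cdot x)(h)=x(hg)$; $\mathrm{Prob}^\Gamma(\mathtt{A}^\Gamma)$ is the set of shift-invariant Borel probability measures. For a finite set $V$, $\sigma\in\mathrm{Hom}(\Gamma,\mathrm{Sym}(V))$ and $x\in\mathtt{A}^V$, let $(\Pi_v^\sigma x)(h)=x(\sigma^h v)$ and $P_x^\sigma=\frac1{|V|}\sum_{v\in V}\delta_{\Pi_v^\sigma x}$. Give $\mathtt{A}^\Gamma$ the metric $d(x,y)=\sum_{\gamma}\mathbf 1_{\{x(\gamma)\ne y(\gamma)\}}(5r^2)^{-d(\gamma,e)}$ and $\mathrm{Prob}^\Gamma(\mathtt{A}^\Gamma)$ the transportation metric $\overline d(\mu,\nu)=\sup\{|\int f\,d\mu-\int f\,d\nu| : f\text{ real-valued 1-Lipschitz}\}$. Let $\Omega(\sigma,\mu,\varepsilon)=\{x\in\mathtt{A}^V:\overline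 d(P_x^\sigma,\mu)<\varepsilon\}$. $\sigma$ is $(F,\delta)$-sofic ($F\subset\Gamma$ finite, $\delta>0$) if $\frac1{|V|}|\{v:\sigma(\gamma_1)v\ne\sigma(\gamma_2)v\text{ for all distinct }\gamma_1,\gamma_2\in F\}|>1-\delta$. A random sofic approximation is a sequence of random $\sigma_n\in\mathrm{Hom}(\Gamma,\mathrm{Sym}(V_n))$, $V_n$ finite, such that for every $(F,\delta)$, $\limsup_n\frac1{|V_n|}\log\mathbb{P}\{\sigma_n\text{ not }(F,\delta)\text{-sofic}\}=-\infty$. $\sigma_1,\sigma_2\in\mathrm{Hom}(\Gamma,\mathrm{Sym}(V))$ differ by a switching if for some $i,j\in V$, $k\in\{1,\dots,r\}$, $\sigma_1^{s_k}(i)=\sigma_2^{s_k}(j)$, $\sigma_1^{s_k}(j)=\sigma_2^{s_k}(i)$, and the generator permutations are otherwise identical; $d(\sigma_1,\sigma_2)=m/|V|$ with $m$ the minimal number of switchings from $\sigma_1$ to $\sigma_2$. The sequence is exponentially concentrated if for some $C>0$, for all $n$, all 1-Lipschitz $f\colon\mathrm{Hom}(\Gamma,\mathrm{Sym}(V_n))\to\mathbb{R}$ and $t>0$, $\mathbb{P}\{|f(\sigma_n)-\mathbb{E}f(\sigma_n)|>t\}\le2e^{-C|V_n|t^2}$. For $h\in[0,\log|\mathtt{A}|]$ let $\rho_\mu(\sigma,h)=\inf\{\varepsilon>0:\frac1{|V|}\log|\Omega(\sigma,\mu,\varepsilon)|\ge h\}$, $\overline\rho_\mu(h)=\limsup_n\mathbb{E}\rho_\mu(\sigma_n,h)$,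 $\underline\rho_\mu(h)=\liminf_n\mathbb{E}\rho_\mu(\sigma_n,h)$. The typical entropies are $h^\flat(\mu)=\sup\{h\in[0,\log|\mathtt A|]:\overline\rho_\mu(h)=0\}$ and $h^\sharp(\mu)=\sup\{h\in[0,\log|\mathtt A|]:\underline\rho_\mu(h)=0\}$, with $\sup\varnothing=-\infty$. *)

theory Defs
  imports "HOL-Probability.Probability" "HOL-Algebra.Bij"
begin

section \<open>The free group\<close>

text \<open>A letter \<open>(i, True)\<close> stands for the generator \<open>s\<^sub>i\<close> and \<open>(i, False)\<close> for its inverse.\<close>

type_synonym 'r letter = "'r \<times> bool"

definition inv_letter :: "'r letter \<Rightarrow> 'r letter" where
  "inv_letter a = (fst a, \<not> snd a)"

definition reduced :: "'r letter list \<Rightarrow> bool" where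
  "reduced w \<longleftrightarrow> successively (\<lambda>a b. b \<noteq> inv_letter a) w"

fun push :: "'r letter \<Rightarrow> 'r letter list \<Rightarrow> 'r letter list" where
  "push a [] = [a]"
| "push a (b # w) = (if b = inv_letter a then w else a # b # w)"

lemma inv_letter_inv_letter [simp]: "inv_letter (inv_letter a) = a"
  by (simp add: inv_letter_def)

lemma reduced_Nil [simp]: "reduced []"
  by (simp add: reduced_def)

lemma reduced_ConsD: "reduced (a # w) \<Longrightarrow> reduced w"
  by (cases w) (auto simp: reduced_def)

lemma reduced_push: "reduced w \<Longrightarrow> reduced (push a w)"
  by (cases w) (auto simp: reduced_def dest: reduced_ConsD[unfolded reduced_def])

lemma reduced_foldr_push: "reduced v \<Longrightarrow> reduced (foldr push u v)"
  by (induction u) (auto intro: reduced_push)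

typedef 'r free_group = "{w :: 'r letter list. reduced w}"
  morphisms word_of Abs_free_group
  by (rule exI[of _ "[]"]) simp

setup_lifting type_definition_free_group

text \<open>Prepending the letters of \<open>u\<close> to the reduced word \<open>v\<close> one at a time, cancelling at each
  step, yields the reduced form of \<open>u @ v\<close>.\<close>

lift_definition free_mult :: "'r free_group \<Rightarrow> 'r free_group \<Rightarrow> 'r free_group"
  is "\<lambda>u v. foldr push u v"
  by (rule reduced_foldr_push)

lift_definition free_one :: "'r free_group" is "[]"
  by simp

lift_definition gen :: "'r \<Rightarrow> 'r free_group" is "\<lambda>i. [(i, True)]"
  by (simp add: reduced_def)

definition word_length :: "'r free_group \<Rightarrow> nat" where
  "word_length g = length (word_of g)"

definition FG :: "'r free_group monoid" where
  "FG = \<lparr>carrier = UNIV, mult = free_mult, one = free_one\<rparr>"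

lemma push_inv_push: "reduced w \<Longrightarrow> push (inv_letter a) (push a w) = w"
  by (cases w; cases "tl w") (auto simp: reduced_def)

lemma foldr_push_push:
  assumes "reduced w"
  shows "foldr push (push a v) w = push a (foldr push v w)"
proof (cases v)
  case (Cons b v')
  have "push a (push (inv_letter a) (foldr push v' w)) = foldr push v' w"
    using push_inv_push[of "foldr push v' w" "inv_letter a"] reduced_foldr_push[OF assms] by simp
  then show ?thesis using Cons by simp
qed simp

lemma foldr_push_assoc:
  "reduced w \<Longrightarrow> foldr push (foldr push u v) w = foldr push u (foldr push v w)"
  by (induction u) (auto simp: foldr_push_push)

lemma foldr_push_Nil: "reduced u \<Longrightarrow> foldr push u [] = u"
proof (induction u)
  case (Cons a u)
  then have "foldr push u [] = u" by (blast dest: reduced_ConsD)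
  then show ?case using Cons.prems by (cases u) (auto simp: reduced_def)
qed simp

lemma foldr_push_inverse:
  "reduced w \<Longrightarrow> foldr push (rev (map inv_letter u)) (foldr push u w) = w"
  by (induction u) (auto simp: push_inv_push reduced_foldr_push)

lemma free_left_inverse: "\<exists>h. free_mult h g = free_one"
proof transfer
  fix g :: "'a letter list" assume g: "reduced g"
  let ?h = "foldr push (rev (map inv_letter g)) []"
  have "foldr push ?h g = foldr push (rev (map inv_letter g)) (foldr push [] g)"
    by (rule foldr_push_assoc[OF g])
  also have "\<dots> = foldr push (rev (map inv_letter g)) (foldr push g [])"
    using foldr_push_Nil[OF g] by simp
  also have "\<dots> = []" by (rule foldr_push_inverse) simp
  finally have "foldr push ?h g = []" .
  moreover have "reduced ?h" by (rule reduced_foldr_push) simp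
  ultimately show "\<exists>h\<in>{w. reduced w}. foldr push h g = []" by blast
qed

theorem group_FG: "group FG"
proof (rule groupI)
  fix x y z :: "'a free_group"
  show "(x \<otimes>\<^bsub>FG\<^esub> y) \<otimes>\<^bsub>FG\<^esub> z = x \<otimes>\<^bsub>FG\<^esub> (y \<otimes>\<^bsub>FG\<^esub> z)"
    unfolding FG_def by (simp, transfer) (rule foldr_push_assoc)
  show "\<one>\<^bsub>FG\<^esub> \<otimes>\<^bsub>FG\<^esub> x = x"
    unfolding FG_def by (simp, transfer) simp
  show "\<exists>y\<in>carrier FG. y \<otimes>\<^bsub>FG\<^esub> x = \<one>\<^bsub>FG\<^esub>"
    using free_left_inverse by (auto simp: FG_def)
qed (auto simp: FG_def)

theorem FG_universal:
  fixes G :: "('b, 'c) monoid_scheme" (structure) and s :: "'r \<Rightarrow> 'b"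
  assumes "group G" and s: "\<And>i. s i \<in> carrier G"
  shows "\<exists>!\<phi>. \<phi> \<in> hom FG G \<and> (\<forall>i. \<phi> (gen i) = s i)"
proof -
  interpret G: group G by fact
  interpret F: group "FG :: 'r free_group monoid" by (rule group_FG)
  define val where "val a = (if snd a then s (fst a) else inv (s (fst a)))" for a :: "'r letter"
  define ev where "ev w = foldr (\<lambda>a z. val a \<otimes> z) w \<one>" for w
  have val: "val a \<in> carrier G" for a using s by (auto simp: val_def)
  have ev: "ev w \<in> carrier G" for w by (induction w) (auto simp: ev_def val)
  have val_inv: "val a \<otimes> val (inv_letter a) = \<one>" for a
    using s by (auto simp: val_def inv_letter_def)
  have ev_push: "ev (push a w) = val a \<otimes> ev w" for a w
  proof (cases w)
    case (Cons b w')
    have "val a \<otimes> (val (inv_letter a) \<otimes> ev w') = ev w'"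
      using val_inv ev val by (simp flip: G.m_assoc)
    then show ?thesis using Cons by (auto simp: ev_def)
  qed (simp add: ev_def)
  have ev_mult: "ev (foldr push u v) = ev u \<otimes> ev v" for u v
  proof (induction u)
    case (Cons a u)
    then have "ev (foldr push (a # u) v) = val a \<otimes> (ev u \<otimes> ev v)" by (simp add: ev_push)
    also have "\<dots> = ev (a # u) \<otimes> ev v" using val ev[of u] ev[of v] by (simp add: ev_def G.m_assoc)
    finally show ?case .
  qed (use ev in \<open>simp add: ev_def\<close>)
  define \<phi> where "\<phi> g = ev (word_of g)" for g
  show ?thesis
  proof (rule ex1I[of _ \<phi>])
    have "\<phi> \<in> hom FG G"
      unfolding hom_def by (auto simp: \<phi>_def ev FG_def free_mult.rep_eq ev_mult)
    moreover have "\<phi> (gen i) = s i" for i using s by (simp add: \<phi>_def gen.rep_eq ev_def val_def)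
    ultimately show "\<phi> \<in> hom FG G \<and> (\<forall>i. \<phi> (gen i) = s i)" by blast
  next
    fix \<psi> assume \<psi>: "\<psi> \<in> hom FG G \<and> (\<forall>i. \<psi> (gen i) = s i)"
    interpret h: group_hom FG G \<psi>
      using \<psi> by unfold_locales auto
    have letter: "\<psi> (Abs_free_group [a]) = val a" for a :: "'r letter"
    proof (cases "snd a")
      case True
      then have "Abs_free_group [a] = gen (fst a)" by (cases a) (simp add: gen_def)
      then show ?thesis using True \<psi> by (simp add: val_def)
    next
      case False
      have "Abs_free_group [a] \<otimes>\<^bsub>FG\<^esub> gen (fst a) = \<one>\<^bsub>FG\<^esub>"
        unfolding FG_def using False
        by (cases a) (simp add: word_of_inject[symmetric] free_mult.rep_eq gen.rep_eq
            free_one.rep_eq Abs_free_group_inverse reduced_def inv_letter_def)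
      then have "Abs_free_group [a] = inv\<^bsub>FG\<^esub> (gen (fst a))"
        by (intro F.inv_equality[symmetric]) (auto simp: FG_def)
      then have "\<psi> (Abs_free_group [a]) = inv (\<psi> (gen (fst a)))"
        by (simp add: FG_def flip: h.hom_inv)
      then show ?thesis using False \<psi> by (simp add: val_def)
    qed
    have "\<psi> (Abs_free_group w) = ev w" if "reduced w" for w
      using that
    proof (induction w)
      case Nil
      have "(Abs_free_group [] :: 'r free_group) = \<one>\<^bsub>FG\<^esub>" by (simp add: FG_def free_one_def)
      then show ?case using h.hom_one by (simp add: ev_def)
    next
      case (Cons a w)
      have w: "reduced w" using Cons.prems by (rule reduced_ConsD)
      have "push a w = a # w" using Cons.prems by (cases w) (auto simp: reduced_def)
      then have "Abs_free_group (a # w) = Abs_free_group [a] \<otimes>\<^bsub>FG\<^esub> Abs_free_group w"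
        using w Cons.prems
        by (simp add: FG_def word_of_inject[symmetric] free_mult.rep_eq Abs_free_group_inverse
            reduced_def)
      then have "\<psi> (Abs_free_group (a # w)) = val a \<otimes> ev w"
        using Cons.IH[OF w] letter h.hom_mult by (simp add: FG_def)
      then show ?case by (simp add: ev_def)
    qed
    then show "\<psi> = \<phi>"
      using word_of by (metis \<phi>_def ext mem_Collect_eq word_of_inverse)
  qed
qed

instance free_group :: (countable) countable
proof
  show "\<exists>f :: 'a free_group \<Rightarrow> nat. inj f"
    by (rule exI[of _ "\<lambda>g. to_nat (word_of g)"]) (auto simp: inj_def word_of_inject)
qed

section \<open>Shift systems\<close>

text \<open>The rank is \<open>r = CARD('r)\<close> and the alphabet is the finite type \<open>'a\<close>.\<close>

type_synonym ('r, 'a) config = "'r free_group \<Rightarrow> 'a"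

definition shift :: "'r free_group \<Rightarrow> ('r, 'a) config \<Rightarrow> ('r, 'a) config" where
  "shift g x = (\<lambda>h. x (h \<otimes>\<^bsub>FG\<^esub> g))"

definition config_borel :: "('r, 'a) config measure" where
  "config_borel = Pi\<^sub>M UNIV (\<lambda>_. count_space UNIV)"

lemma space_config_borel [simp]: "space config_borel = UNIV"
  by (simp add: config_borel_def space_PiM)

text \<open>This is the Borel \<open>\<sigma>\<close>-algebra of the product of the discrete topologies.\<close>

lemma sets_config_borel:
  "sets (config_borel :: ('r::finite, 'a::finite) config measure) =
     sigma_sets UNIV {U. openin (product_topology (\<lambda>_. discrete_topology UNIV) UNIV) U}"
  (is "_ = sigma_sets UNIV ?O")
proof
  let ?F = "{f :: ('r, 'a) config set. \<exists>i A. f = {x. x i \<in> A}}"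
  show "sets config_borel \<subseteq> sigma_sets UNIV ?O"
  proof -
    have *: "{x :: ('r, 'a) config. x i \<in> A} \<in> ?O" for i A
      using openin_continuous_map_preimage[OF continuous_map_product_projection[of i UNIV
          "\<lambda>_ :: 'r free_group. discrete_topology (UNIV :: 'a set)"], of A]
      by simp
    have "sets (config_borel :: ('r, 'a) config measure) = sigma_sets UNIV ?F"
      unfolding config_borel_def sets_PiM_single by (simp add: PiE_UNIV_domain)
    also have "\<dots> \<subseteq> sigma_sets UNIV ?O"
      using * by (intro sigma_sets_mono') auto
    finally show ?thesis .
  qed
  show "sigma_sets UNIV ?O \<subseteq> sets (config_borel :: ('r, 'a) config measure)"
  proof -
    define cyl where "cyl S y = {x :: ('r, 'a) config. \<forall>i\<in>S. x i = y i}" for S y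
    define \<C> where "\<C> = (\<lambda>(S, l). cyl S (\<lambda>i. if i \<in> S then l ! to_nat i else undefined))
      ` (Collect finite \<times> (UNIV :: 'a list set))"
    have cyl: "cyl S y \<in> sets config_borel" if "finite S" for S y
    proof -
      have "cyl S y = (\<Inter>i\<in>S. {x. x i \<in> {y i}})" by (auto simp: cyl_def)
      moreover have "{x :: ('r, 'a) config. x i \<in> {y i}} \<in> sets config_borel" for i
        unfolding config_borel_def using measurable_sets[OF measurable_component_singleton[of i UNIV
            "\<lambda>_. count_space (UNIV :: 'a set)"], of "{y i}"]
        by (simp add: space_PiM vimage_def)
      ultimately show ?thesis using that
        by (cases "S = {}") (auto intro!: sets.finite_INT simp: sets.top[of config_borel, simplified])
    qed
    have countC: "countable \<C>"
      unfolding \<C>_def by (intro countable_image countable_SIGMA countable_Collect_finite) auto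
    have sub: "\<C> \<subseteq> sets config_borel" by (auto simp: \<C>_def intro: cyl)
    have inC: "cyl S y \<in> \<C>" if S: "finite S" for S and y :: "('r, 'a) config"
    proof -
      define m where "m = Suc (Max (insert 0 (to_nat ` S)))"
      define l where "l = map (\<lambda>k. y (from_nat k)) [0..<m]"
      have "to_nat i < m" if "i \<in> S" for i
        using S that by (auto simp: m_def less_Suc_eq_le intro!: Max_ge)
      then have "l ! to_nat i = y i" if "i \<in> S" for i using that by (simp add: l_def)
      then have "cyl S y = cyl S (\<lambda>i. if i \<in> S then l ! to_nat i else undefined)"
        by (auto simp: cyl_def)
      then show ?thesis using S by (auto simp: \<C>_def intro!: image_eqI[of _ _ "(S, l)"])
    qed
    have "?O \<subseteq> sets config_borel"
    proof
      fix U :: "('r, 'a) config set" assume "U \<in> ?O"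
      have "\<exists>C\<in>\<C>. x \<in> C \<and> C \<subseteq> U" if x: "x \<in> U" for x
      proof -
        obtain W where W: "finite {i. W i \<noteq> UNIV}" "x \<in> Pi\<^sub>E UNIV W" "Pi\<^sub>E UNIV W \<subseteq> U"
          using \<open>U \<in> ?O\<close> x by (simp add: openin_product_topology_alt) blast
        have "y i \<in> W i" if "y \<in> cyl {i. W i \<noteq> UNIV} x" for y i
          using that W(2) by (cases "W i = UNIV") (auto simp: cyl_def PiE_iff)
        then have "cyl {i. W i \<noteq> UNIV} x \<subseteq> U"
          by (intro order.trans[OF _ W(3)]) (auto simp: PiE_UNIV_domain)
        then show ?thesis using inC[OF W(1)] by (intro bexI[of _ "cyl {i. W i \<noteq> UNIV} x"])
            (auto simp: cyl_def)
      qed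
      then have "U = \<Union>{C\<in>\<C>. C \<subseteq> U}" by blast
      also have "\<dots> \<in> sets config_borel"
        using countC sub by (intro sets.countable_Union) auto
      finally show "U \<in> sets config_borel" .
    qed
    then show ?thesis
      using sets.sigma_sets_subset[of ?O config_borel] by simp
  qed
qed

definition shift_invariant_probs :: "('r, 'a) config measure set" where
  "shift_invariant_probs = {\<mu>. sets \<mu> = sets config_borel \<and> prob_space \<mu> \<and>
     (\<forall>g. distr \<mu> config_borel (shift g) = \<mu>)}"

text \<open>Isomorphism modulo null sets.\<close>

definition isomorphic_systems ::
    "('r, 'a) config measure \<Rightarrow> ('r, 'b) config measure \<Rightarrow> bool" where
  "isomorphic_systems \<mu> \<nu> \<longleftrightarrow>
     (\<exists>\<phi> \<in> measurable config_borel config_borel. \<exists>\<psi> \<in> measurable config_borel config_borel.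
        distr \<mu> config_borel \<phi> = \<nu> \<and>
        (AE x in \<mu>. \<psi> (\<phi> x) = x) \<and> (AE y in \<nu>. \<phi> (\<psi> y) = y) \<and>
        (\<forall>g. AE x in \<mu>. \<phi> (shift g x) = shift g (\<phi> x)))"

definition config_dist :: "('r::finite, 'a) config \<Rightarrow> ('r, 'a) config \<Rightarrow> real" where
  "config_dist x y =
     (\<Sum>\<^sub>\<infinity>\<gamma>. of_bool (x \<gamma> \<noteq> y \<gamma>) * (5 * real CARD('r)^2) powi (- int (word_length \<gamma>)))"

definition transport_dist ::
    "('r::finite, 'a) config measure \<Rightarrow> ('r, 'a) config measure \<Rightarrow> real" where
  "transport_dist \<mu> \<nu> =
     (SUP f \<in> {f. \<forall>x y. \<bar>f x - f y\<bar> \<le> config_dist x y}.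
        \<bar>integral\<^sup>L \<mu> f - integral\<^sup>L \<nu> f\<bar>)"

section \<open>Sofic approximations\<close>

definition perm_homs :: "'v set \<Rightarrow> ('r free_group \<Rightarrow> 'v \<Rightarrow> 'v) set" where
  "perm_homs V = hom FG (BijGroup V)"

definition sofic ::
    "'v set \<Rightarrow> 'r free_group set \<Rightarrow> real \<Rightarrow> ('r free_group \<Rightarrow> 'v \<Rightarrow> 'v) \<Rightarrow> bool" where
  "sofic V F \<delta> \<sigma> \<longleftrightarrow>
     1 / real (card V) *
       real (card {v\<in>V. \<forall>\<gamma>\<^sub>1\<in>F. \<forall>\<gamma>\<^sub>2\<in>F. \<gamma>\<^sub>1 \<noteq> \<gamma>\<^sub>2 \<longrightarrow> \<sigma> \<gamma>\<^sub>1 v \<noteq> \<sigma> \<gamma>\<^sub>2 v}) > 1 - \<delta>"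

text \<open>The logarithm with \<open>log 0 = -\<infinity>\<close>; the library sets \<open>ln 0 = 0\<close>.\<close>

definition elog :: "real \<Rightarrow> ereal" where
  "elog p = (if p = 0 then -\<infinity> else ereal (ln p))"

text \<open>Only the laws of the random homomorphisms matter.  As \<open>perm_homs V\<close> is finite for finite
  \<open>V\<close>, they are given as probability mass functions.\<close>

definition random_sofic_approximation ::
    "(nat \<Rightarrow> 'v set) \<Rightarrow> (nat \<Rightarrow> ('r free_group \<Rightarrow> 'v \<Rightarrow> 'v) pmf) \<Rightarrow> bool" where
  "random_sofic_approximation V P \<longleftrightarrow>
     (\<forall>n. finite (V n) \<and> V n \<noteq> {} \<and> set_pmf (P n) \<subseteq> perm_homs (V n)) \<and>
     (\<forall>F \<delta>. finite F \<and> \<delta> > 0 \<longrightarrow>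
        limsup (\<lambda>n. ereal (1 / real (card (V n))) *
          elog (measure_pmf.prob (P n) {\<sigma>. \<not> sofic (V n) F \<delta> \<sigma>})) = -\<infinity>)"

definition switching ::
    "'v set \<Rightarrow> ('r free_group \<Rightarrow> 'v \<Rightarrow> 'v) \<Rightarrow> ('r free_group \<Rightarrow> 'v \<Rightarrow> 'v) \<Rightarrow> bool" where
  "switching V \<sigma>\<^sub>1 \<sigma>\<^sub>2 \<longleftrightarrow> \<sigma>\<^sub>1 \<in> perm_homs V \<and> \<sigma>\<^sub>2 \<in> perm_homs V \<and>
     (\<exists>i\<in>V. \<exists>j\<in>V. \<exists>k.
        \<sigma>\<^sub>1 (gen k) i = \<sigma>\<^sub>2 (gen k) j \<and> \<sigma>\<^sub>1 (gen k) j = \<sigma>\<^sub>2 (gen k) i \<and>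
        (\<forall>l. \<forall>v\<in>V. \<not> (l = k \<and> v \<in> {i, j}) \<longrightarrow> \<sigma>\<^sub>1 (gen l) v = \<sigma>\<^sub>2 (gen l) v))"

definition hom_dist ::
    "'v set \<Rightarrow> ('r free_group \<Rightarrow> 'v \<Rightarrow> 'v) \<Rightarrow> ('r free_group \<Rightarrow> 'v \<Rightarrow> 'v) \<Rightarrow> real" where
  "hom_dist V \<sigma>\<^sub>1 \<sigma>\<^sub>2 = real (LEAST m. (switching V ^^ m) \<sigma>\<^sub>1 \<sigma>\<^sub>2) / real (card V)"

definition exponentially_concentrated ::
    "(nat \<Rightarrow> 'v set) \<Rightarrow> (nat \<Rightarrow> ('r free_group \<Rightarrow> 'v \<Rightarrow> 'v) pmf) \<Rightarrow> bool" where
  "exponentially_concentrated V P \<longleftrightarrow>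
     (\<exists>C>0. \<forall>n f. \<forall>t>0.
        (\<forall>\<sigma>\<^sub>1\<in>perm_homs (V n). \<forall>\<sigma>\<^sub>2\<in>perm_homs (V n). \<bar>f \<sigma>\<^sub>1 - f \<sigma>\<^sub>2\<bar> \<le> hom_dist (V n) \<sigma>\<^sub>1 \<sigma>\<^sub>2) \<longrightarrow>
        measure_pmf.prob (P n) {\<sigma>. \<bar>f \<sigma> - measure_pmf.expectation (P n) f\<bar> > t}
          \<le> 2 * exp (- C * real (card (V n)) * t^2))"

section \<open>Typical entropies\<close>

definition pullback_name ::
    "('r free_group \<Rightarrow> 'v \<Rightarrow> 'v) \<Rightarrow> ('v \<Rightarrow> 'a) \<Rightarrow> 'v \<Rightarrow> ('r, 'a) config" where
  "pullback_name \<sigma> x v = (\<lambda>h. x (\<sigma> h v))"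

definition empirical_distribution ::
    "'v set \<Rightarrow> ('r free_group \<Rightarrow> 'v \<Rightarrow> 'v) \<Rightarrow> ('v \<Rightarrow> 'a) \<Rightarrow> ('r, 'a) config measure" where
  "empirical_distribution V \<sigma> x = distr (uniform_count_measure V) config_borel (pullback_name \<sigma> x)"

lemma measure_empirical_distribution:
  assumes "finite V" and B: "B \<in> sets config_borel"
  shows "measure (empirical_distribution V \<sigma> x) B =
    1 / real (card V) * (\<Sum>v\<in>V. measure (return config_borel (pullback_name \<sigma> x v)) B)"
proof -
  have "measure (empirical_distribution V \<sigma> x) B =
      measure (uniform_count_measure V) {v\<in>V. pullback_name \<sigma> x v \<in> B}"
    unfolding empirical_distribution_def using B
    by (subst measure_distr)
      (auto simp: measurable_def sets_uniform_count_measure space_uniform_count_measure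
        intro!: arg_cong[where f = "measure _"])
  also have "\<dots> = card {v\<in>V. pullback_name \<sigma> x v \<in> B} / card V"
    using assms by (intro measure_uniform_count_measure) auto
  also have "\<dots> = 1 / real (card V) * (\<Sum>v\<in>V. indicator B (pullback_name \<sigma> x v))"
    using assms by (simp add: indicator_def sum.If_cases Int_def)
  finally show ?thesis using B by (simp add: measure_return)
qed

definition good_models ::
    "'v set \<Rightarrow> ('r::finite free_group \<Rightarrow> 'v \<Rightarrow> 'v) \<Rightarrow> ('r, 'a) config measure \<Rightarrow> real \<Rightarrow>
     ('v \<Rightarrow> 'a) set" where
  "good_models V \<sigma> \<mu> \<epsilon> =
     {x \<in> V \<rightarrow>\<^sub>E UNIV. transport_dist (empirical_distribution V \<sigma> x) \<mu> < \<epsilon>}"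

definition rho ::
    "'v set \<Rightarrow> ('r::finite, 'a) config measure \<Rightarrow> ('r free_group \<Rightarrow> 'v \<Rightarrow> 'v) \<Rightarrow> real \<Rightarrow> real" where
  "rho V \<mu> \<sigma> h =
     Inf {\<epsilon>. \<epsilon> > 0 \<and>
       ereal (1 / real (card V)) * elog (real (card (good_models V \<sigma> \<mu> \<epsilon>))) \<ge> ereal h}"

definition rho_upper ::
    "(nat \<Rightarrow> 'v set) \<Rightarrow> (nat \<Rightarrow> ('r::finite free_group \<Rightarrow> 'v \<Rightarrow> 'v) pmf) \<Rightarrow>
     ('r, 'a) config measure \<Rightarrow> real \<Rightarrow> ereal" where
  "rho_upper V P \<mu> h =
     limsup (\<lambda>n. ereal (measure_pmf.expectation (P n) (\<lambda>\<sigma>. rho (V n) \<mu> \<sigma> h)))"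

definition rho_lower ::
    "(nat \<Rightarrow> 'v set) \<Rightarrow> (nat \<Rightarrow> ('r::finite free_group \<Rightarrow> 'v \<Rightarrow> 'v) pmf) \<Rightarrow>
     ('r, 'a) config measure \<Rightarrow> real \<Rightarrow> ereal" where
  "rho_lower V P \<mu> h =
     liminf (\<lambda>n. ereal (measure_pmf.expectation (P n) (\<lambda>\<sigma>. rho (V n) \<mu> \<sigma> h)))"

text \<open>In \<^typ>\<open>ereal\<close> the supremum of the empty set is \<open>-\<infinity>\<close>.\<close>

definition h_flat ::
    "(nat \<Rightarrow> 'v set) \<Rightarrow> (nat \<Rightarrow> ('r::finite free_group \<Rightarrow> 'v \<Rightarrow> 'v) pmf) \<Rightarrow>
     ('r, 'a::finite) config measure \<Rightarrow> ereal" where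
  "h_flat V P \<mu> = Sup {ereal h | h. h \<in> {0..ln (real CARD('a))} \<and> rho_upper V P \<mu> h = 0}"

definition h_sharp ::
    "(nat \<Rightarrow> 'v set) \<Rightarrow> (nat \<Rightarrow> ('r::finite free_group \<Rightarrow> 'v \<Rightarrow> 'v) pmf) \<Rightarrow>
     ('r, 'a::finite) config measure \<Rightarrow> ereal" where
  "h_sharp V P \<mu> = Sup {ereal h | h. h \<in> {0..ln (real CARD('a))} \<and> rho_lower V P \<mu> h = 0}"

end

theory Submission
  imports Defs
begin

text \<open>The entropies \<open>h_sharp\<close> and \<open>h_flat\<close> are read off from the numbers of good models of the two
  systems over the same \<open>\<sigma>\<close>, so it is enough to carry good models of \<open>\<mu>\<close> to good models of \<open>\<nu>\<close>
  with a subexponential loss in their number, uniformly in \<open>\<sigma>\<close>.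

  Let \<open>\<phi>\<close> be an isomorphism from \<open>\<mu>\<close> to \<open>\<nu>\<close> with inverse \<open>\<psi>\<close>.  The symbol \<open>\<phi> x \<one>\<close> is approximated
  in measure by a function \<open>f\<close> of finitely many coordinates, and likewise \<open>\<psi> y \<one>\<close> by \<open>g\<close>
  (\<open>approximate_by_block_code\<close>).  Applying \<open>f\<close> at every vertex maps a labelling \<open>x\<close> of \<open>V\<close> to a
  labelling \<open>T x\<close>, and since \<open>\<sigma>\<close> is an exact action of the free group, the empirical distribution of
  \<open>T x\<close> is the image of that of \<open>x\<close> under the block code of \<open>f\<close> (\<open>pullback_apply_code\<close>).  That
  block code is Lipschitz, because translating by a group element distorts the weights of the metric
  by a bounded factor (\<open>config_dist_code_le\<close>).  So if \<open>x\<close> is a good enough model of \<open>\<mu>\<close>, then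
  \<open>T x\<close> is a good model of the image of \<open>\<mu>\<close> under the block code, which is close to \<open>\<nu>\<close>.

  The map \<open>T\<close> is nearly injective.  Recovering \<open>x\<close> from \<open>T x\<close> by \<open>g\<close> fails at the vertices where a
  local event occurs whose \<open>\<mu>\<close>-measure is small; since \<open>x\<close> is a good model, only a small
  proportion of vertices is affected.  Each fibre of \<open>T\<close> thus lies in a small Hamming ball, which has
  at most \<open>exp (\<eta> * |V|)\<close> points (\<open>hamming_ball_card_le\<close>).  This proves
  \<open>card_good_models_transfer\<close>.

  In terms of \<open>rho\<close> it says that for \<open>h' = max 0 (h - \<eta>)\<close> and every \<open>\<epsilon>'\<close> there is a \<open>K\<close> with
  \<open>rho V \<nu> \<sigma> h' \<le> \<epsilon>' + K * rho V \<mu> \<sigma> h\<close> for all \<open>\<sigma>\<close> (\<open>rho_transfer\<close>).  This inequality passes to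
  expectations, upper limits and lower limits: a zero of \<open>rho_upper\<close> or \<open>rho_lower\<close> for \<open>\<mu>\<close> at \<open>h\<close>
  yields zeros for \<open>\<nu>\<close> at points arbitrarily close to \<open>h\<close>.  Exchanging the two systems gives equality
  of the suprema.  The truncation at \<open>0\<close> keeps apart the value \<open>0\<close> and the value \<open>-\<infinity>\<close>
  of the entropies: at \<open>h = 0\<close> the inequality compares the existence of good models.\<close>

section \<open>The metric on configurations\<close>

definition weight :: "'r::finite free_group \<Rightarrow> real" where
  "weight \<gamma> = (5 * real CARD('r)^2) powi (- int (word_length \<gamma>))"

lemma weight_eq: "weight (\<gamma> :: 'r::finite free_group) = inverse (5 * real CARD('r)^2) ^ word_length \<gamma>"
  unfolding weight_def power_int_minus power_int_of_nat by (rule power_inverse[symmetric])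

lemma weight_pos [simp]: "weight \<gamma> > 0"
  by (simp add: weight_eq)

lemma weight_nonneg [simp]: "weight \<gamma> \<ge> 0"
  using weight_pos[of \<gamma>] by linarith

text \<open>There are at most \<open>(2 * r)^n\<close> words of length \<open>n\<close>, so the base \<open>5 * r\<^sup>2\<close> beats the growth
  of the free group and the total weight is at most \<open>\<Sum>n. (2 / 5)^n\<close>.\<close>

lemma summable_weight: "(weight :: 'r::finite free_group \<Rightarrow> real) summable_on UNIV"
proof (rule nonneg_bdd_above_summable_on)
  let ?c = "inverse (5 * real CARD('r)^2)"
  have "sum weight F \<le> 1 / (1 - 2 / 5)" if F: "finite F" for F :: "'r free_group set"
  proof -
    define N where "N = Max (insert 0 (word_length ` F))"
    define L where "L n = {u :: 'r letter list. set u \<subseteq> UNIV \<and> length u = n}" for n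
    have L: "finite (L n)" "card (L n) = (2 * CARD('r)) ^ n" for n
      unfolding L_def using finite_lists_length_eq[of "UNIV :: 'r letter set" n]
        card_lists_length_eq[of "UNIV :: 'r letter set" n] by (simp_all add: card_prod mult.commute)
    have r1: "real CARD('r) \<ge> 1" using zero_less_card_finite[where 'a = 'r] by linarith
    then have rpos: "real CARD('r) > 0" by linarith
    have ratio: "2 * real CARD('r) * ?c \<le> 2 / 5"
      using r1 rpos by (simp add: field_simps power2_eq_square)
    have "sum weight F = (\<Sum>u\<in>word_of ` F. ?c ^ length u)"
      by (subst sum.reindex) (auto simp: inj_on_def word_of_inject weight_eq word_length_def)
    also have "\<dots> \<le> (\<Sum>u\<in>(\<Union>n\<in>{..N}. L n). ?c ^ length u)"
    proof (rule sum_mono2)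
      show "word_of ` F \<subseteq> (\<Union>n\<in>{..N}. L n)"
        using F by (auto simp: N_def L_def word_length_def intro!: Max_ge)
    qed (use L in auto)
    also have "\<dots> = (\<Sum>n\<le>N. \<Sum>u\<in>L n. ?c ^ length u)"
      by (intro sum.UNION_disjoint) (use L in \<open>auto simp: L_def\<close>)
    also have "\<dots> = (\<Sum>n\<le>N. (2 * real CARD('r) * ?c) ^ n)"
    proof (intro sum.cong refl)
      fix n
      have "(\<Sum>u\<in>L n. ?c ^ length u) = (\<Sum>u\<in>L n. ?c ^ n)" by (simp add: L_def)
      then show "(\<Sum>u\<in>L n. ?c ^ length u) = (2 * real CARD('r) * ?c) ^ n"
        by (simp only: sum_constant L power_mult_distrib) (simp add: power_mult_distrib)
    qed
    also have "\<dots> \<le> (\<Sum>n\<le>N. (2 / 5) ^ n)"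
      using ratio by (intro sum_mono power_mono) auto
    also have "\<dots> \<le> (\<Sum>n. (2 / 5) ^ n)"
      by (intro sum_le_suminf summable_geometric) auto
    also have "\<dots> = 1 / (1 - 2 / 5)" by (intro suminf_geometric) auto
    finally show ?thesis .
  qed
  then show "bdd_above (sum (weight :: 'r free_group \<Rightarrow> real) ` {F. F \<subseteq> UNIV \<and> finite F})"
    by (intro bdd_aboveI2[of _ _ "1 / (1 - 2 / 5)"]) auto
qed simp

definition total_weight :: "'r::finite itself \<Rightarrow> real" where
  "total_weight _ = (\<Sum>\<^sub>\<infinity>\<gamma> :: 'r free_group. weight \<gamma>)"

lemma sum_weight_le: "finite G \<Longrightarrow> sum weight (G :: 'r::finite free_group set) \<le> total_weight TYPE('r)"
  unfolding total_weight_def by (intro finite_sum_le_infsum summable_weight) auto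

lemma total_weight_nonneg: "total_weight TYPE('r::finite) \<ge> 0"
  unfolding total_weight_def by (intro infsum_nonneg) auto

lemma config_dist_eq: "config_dist x y = (\<Sum>\<^sub>\<infinity>\<gamma>. of_bool (x \<gamma> \<noteq> y \<gamma>) * weight \<gamma>)"
  by (simp add: config_dist_def weight_def)

lemma summable_config_dist:
  "(\<lambda>\<gamma> :: 'r::finite free_group. of_bool (x \<gamma> \<noteq> y \<gamma>) * weight \<gamma>) summable_on A"
  by (rule summable_on_comparison_test[OF summable_on_subset_banach[OF summable_weight]]) auto

lemma config_dist_nonneg: "config_dist x y \<ge> 0"
  unfolding config_dist_eq by (intro infsum_nonneg) auto

lemma config_dist_le_total: "config_dist (x :: ('r::finite, 'a) config) y \<le> total_weight TYPE('r)"
  unfolding config_dist_eq total_weight_def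
  by (intro infsum_mono summable_config_dist summable_weight) auto

lemma sum_le_config_dist:
  "finite G \<Longrightarrow> (\<Sum>\<gamma>\<in>G. of_bool (x \<gamma> \<noteq> y \<gamma>) * weight \<gamma>) \<le> config_dist x y"
  unfolding config_dist_eq by (intro finite_sum_le_infsum summable_config_dist) auto

lemma config_dist_leI:
  assumes "\<And>H. finite H \<Longrightarrow> (\<Sum>\<gamma>\<in>H. of_bool (x \<gamma> \<noteq> y \<gamma>) * weight \<gamma>) \<le> b"
  shows "config_dist x y \<le> b"
  unfolding config_dist_eq by (intro infsum_le_finite_sums summable_config_dist assms) auto

text \<open>A finite set \<open>G\<close> carries all but \<open>\<tau>\<close> of the total weight, and this does not involve the two
  points.  The uniformity makes Lipschitz functions continuous, and it lets a finite sum stand in for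
  the series when the metric is integrated.\<close>

lemma config_dist_truncate:
  assumes "\<tau> > 0"
  shows "\<exists>G :: 'r::finite free_group set. finite G \<and>
    (\<forall>x y :: ('r, 'a) config. config_dist x y \<le> (\<Sum>\<gamma>\<in>G. of_bool (x \<gamma> \<noteq> y \<gamma>) * weight \<gamma>) + \<tau>)"
proof -
  have "(weight has_sum total_weight TYPE('r)) (UNIV :: 'r free_group set)"
    unfolding total_weight_def using summable_weight by (rule has_sum_infsum)
  then have "\<forall>\<^sub>F G in finite_subsets_at_top (UNIV :: 'r free_group set).
      dist (sum weight G) (total_weight TYPE('r)) < \<tau>"
    unfolding has_sum_def using assms by (rule tendstoD)
  then obtain G :: "'r free_group set" where G: "finite G" "total_weight TYPE('r) - \<tau> < sum weight G"
    unfolding eventually_finite_subsets_at_top dist_real_def by fastforce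
  have "config_dist x y \<le> (\<Sum>\<gamma>\<in>G. of_bool (x \<gamma> \<noteq> y \<gamma>) * weight \<gamma>) + \<tau>" for x y :: "('r, 'a) config"
  proof (rule config_dist_leI)
    fix H :: "'r free_group set" assume H: "finite H"
    let ?a = "\<lambda>\<gamma>. of_bool (x \<gamma> \<noteq> y \<gamma>) * weight \<gamma>"
    have "sum ?a H \<le> sum ?a (G \<union> H)" using G H by (intro sum_mono2) auto
    also have "\<dots> = sum ?a G + sum ?a (H - G)"
      using G H by (subst sum.union_disjoint[symmetric]) (auto intro: sum.cong)
    also have "sum ?a (H - G) \<le> sum weight (H - G)" by (intro sum_mono) auto
    also have "sum weight (H - G) = sum weight (G \<union> H) - sum weight G"
      using G H by (subst Un_Diff_cancel[symmetric], subst sum.union_disjoint) auto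
    also have "sum weight (G \<union> H) \<le> total_weight TYPE('r)" using G H by (intro sum_weight_le) auto
    finally show "sum ?a H \<le> sum ?a G + \<tau>" using G(2) by linarith
  qed
  then show ?thesis using G(1) by blast
qed

lemma word_length_mult: "word_length (g \<otimes>\<^bsub>FG\<^esub> h) \<le> word_length g + word_length h"
proof -
  have push: "length (push a w) \<le> Suc (length w)" for a :: "'r letter" and w by (cases w) auto
  have "length (foldr push u v) \<le> length u + length v" for u v :: "'r letter list"
  proof (induction u)
    case (Cons a u)
    then show ?case using push[of a "foldr push u v"] by simp
  qed simp
  then show ?thesis by (simp add: word_length_def FG_def free_mult.rep_eq)
qed

lemma weight_mult: "weight g * weight h \<le> weight (g \<otimes>\<^bsub>FG\<^esub> h)"
proof -
  have "real CARD('a) ^ 2 \<ge> 1" using zero_less_card_finite[where 'a = 'a]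
    by (metis One_nat_def Suc_leI of_nat_1 of_nat_le_iff one_le_power)
  then have c: "inverse (5 * real CARD('a)^2) \<le> 1" by (intro inverse_le_1_iff[THEN iffD2]) linarith
  then show ?thesis unfolding weight_eq power_add[symmetric]
    by (intro power_decreasing word_length_mult) auto
qed

section \<open>Lipschitz functions and the transportation metric\<close>

definition config_lipschitz :: "real \<Rightarrow> (('r::finite, 'a) config \<Rightarrow> real) \<Rightarrow> bool" where
  "config_lipschitz L f \<longleftrightarrow> (\<forall>x y. \<bar>f x - f y\<bar> \<le> L * config_dist x y)"

lemma config_lipschitzD: "config_lipschitz L f \<Longrightarrow> \<bar>f x - f y\<bar> \<le> L * config_dist x y"
  by (simp add: config_lipschitz_def)

text \<open>By truncation a Lipschitz function is continuous for the product topology, and the Borel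
  \<open>\<sigma>\<close>-algebra of that topology is the product \<open>\<sigma>\<close>-algebra.\<close>

lemma borel_measurable_config_lipschitz:
  fixes f :: "('r::finite, 'a::finite) config \<Rightarrow> real"
  assumes f: "config_lipschitz L f" and L: "L \<ge> 0"
  shows "f \<in> borel_measurable config_borel"
proof (subst borel_measurable_iff_greater, intro allI)
  fix c :: real
  let ?U = "{x. c < f x}"
  have "openin (product_topology (\<lambda>_ :: 'r free_group. discrete_topology (UNIV :: 'a set)) UNIV) ?U"
    unfolding openin_product_topology_alt
  proof (intro conjI ballI)
    fix x assume "x \<in> ?U"
    define \<tau> where "\<tau> = (f x - c) / (L + 1)"
    have \<tau>: "\<tau> > 0" using \<open>x \<in> ?U\<close> L by (simp add: \<tau>_def)
    obtain G :: "'r free_group set" where G: "finite G"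
      "\<And>x y :: ('r, 'a) config. config_dist x y \<le> (\<Sum>\<gamma>\<in>G. of_bool (x \<gamma> \<noteq> y \<gamma>) * weight \<gamma>) + \<tau>"
      using config_dist_truncate[OF \<tau>] by blast
    define W where "W g = (if g \<in> G then {x g} else UNIV)" for g
    have "c < f y" if y: "y \<in> Pi\<^sub>E UNIV W" for y
    proof -
      have "y g = x g" if "g \<in> G" for g using y that by (auto simp: W_def PiE_iff split: if_splits)
      then have "config_dist x y \<le> \<tau>" using G(2)[of x y] by simp
      then have "L * config_dist x y \<le> L * \<tau>" using L by (rule mult_left_mono)
      moreover have "L * \<tau> < (L + 1) * \<tau>" using \<tau> by simp
      moreover have "(L + 1) * \<tau> = f x - c" using L by (simp add: \<tau>_def)
      ultimately show ?thesis using config_lipschitzD[OF f, of x y] by linarith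
    qed
    moreover have "finite {g. W g \<noteq> UNIV}"
      using G(1) by (rule rev_finite_subset) (auto simp: W_def)
    moreover have "x \<in> Pi\<^sub>E UNIV W" by (auto simp: W_def)
    ultimately show "\<exists>X. finite {i \<in> UNIV. X i \<noteq> topspace (discrete_topology UNIV)} \<and>
        (\<forall>i\<in>UNIV. openin (discrete_topology UNIV) (X i)) \<and> x \<in> Pi\<^sub>E UNIV X \<and> Pi\<^sub>E UNIV X \<subseteq> ?U"
      by (intro exI[of _ W]) auto
  qed
  then show "{w \<in> space config_borel. c < f w} \<in> sets config_borel"
    by (simp add: sets_config_borel sigma_sets.Basic)
qed

lemma config_lipschitz_bounded:
  fixes f :: "('r::finite, 'a) config \<Rightarrow> real"
  assumes "config_lipschitz L f" and L: "L \<ge> 0"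
  shows "\<bar>f x - f y\<bar> \<le> L * total_weight TYPE('r)"
  using config_lipschitzD[OF assms(1), of x y] mult_left_mono[OF config_dist_le_total[of x y] L]
  by linarith

locale config_prob = prob_space \<mu> for \<mu> :: "('r::finite, 'a::finite) config measure" +
  assumes sets_eq [measurable_cong]: "sets \<mu> = sets config_borel"
begin

lemma space_eq: "space \<mu> = UNIV"
  using sets_eq_imp_space_eq[OF sets_eq] by simp

lemma integrable_config_lipschitz:
  assumes f: "config_lipschitz L f" and L: "L \<ge> 0"
  shows "integrable \<mu> f"
proof (rule integrable_const_bound)
  have "\<bar>f x\<bar> \<le> \<bar>f undefined\<bar> + L * total_weight TYPE('r)" for x
    using config_lipschitz_bounded[OF f L, of x undefined] by linarith
  then show "AE x in \<mu>. norm (f x) \<le> \<bar>f undefined\<bar> + L * total_weight TYPE('r)" by simp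
  show "f \<in> borel_measurable \<mu>"
    using borel_measurable_config_lipschitz[OF f L] by (simp cong: measurable_cong_sets add: sets_eq)
qed

end

lemma config_lipschitz_integral_diff_le:
  fixes \<mu> \<nu> :: "('r::finite, 'a::finite) config measure"
  assumes "config_prob \<mu>" "config_prob \<nu>" and f: "config_lipschitz 1 f"
  shows "\<bar>integral\<^sup>L \<mu> f - integral\<^sup>L \<nu> f\<bar> \<le> total_weight TYPE('r)"
proof -
  have one_sided: "integral\<^sup>L \<mu> f - total_weight TYPE('r) \<le> integral\<^sup>L \<nu> f"
    if "config_prob \<mu>" "config_prob \<nu>" for \<mu> \<nu> :: "('r, 'a) config measure"
  proof -
    interpret \<mu>: config_prob \<mu> by fact
    interpret \<nu>: config_prob \<nu> by fact
    have "f x \<le> f y + total_weight TYPE('r)" for x y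
      using config_lipschitz_bounded[OF f, of x y] by simp
    then have "integral\<^sup>L \<mu> f \<le> f y + total_weight TYPE('r)" for y
      using \<mu>.integrable_config_lipschitz[OF f] by (intro \<mu>.integral_le_const) auto
    then show ?thesis
      using \<nu>.integrable_config_lipschitz[OF f]
      by (intro \<nu>.integral_ge_const) (auto simp: algebra_simps)
  qed
  show ?thesis
    using one_sided[OF assms(1,2)] one_sided[OF assms(2,1)] by linarith
qed

lemma transport_dist_eq:
  "transport_dist \<mu> \<nu> = (SUP f \<in> {f. config_lipschitz 1 f}. \<bar>integral\<^sup>L \<mu> f - integral\<^sup>L \<nu> f\<bar>)"
  by (simp add: transport_dist_def config_lipschitz_def)

lemma config_lipschitz_const: "L \<ge> 0 \<Longrightarrow> config_lipschitz L (\<lambda>_. c)"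
  by (simp add: config_lipschitz_def config_dist_nonneg)

lemma transport_dist_leI:
  assumes "\<And>f. config_lipschitz 1 f \<Longrightarrow> \<bar>integral\<^sup>L \<mu> f - integral\<^sup>L \<nu> f\<bar> \<le> b"
  shows "transport_dist \<mu> \<nu> \<le> b"
  unfolding transport_dist_eq
  by (rule cSUP_least) (use assms config_lipschitz_const[of 1 0] in auto)

lemma integral_diff_le_transport_dist:
  fixes \<mu> \<nu> :: "('r::finite, 'a::finite) config measure"
  assumes "config_prob \<mu>" "config_prob \<nu>" and f: "config_lipschitz L f" and L: "L > 0"
  shows "\<bar>integral\<^sup>L \<mu> f - integral\<^sup>L \<nu> f\<bar> \<le> L * transport_dist \<mu> \<nu>"
proof -
  have lip: "config_lipschitz 1 (\<lambda>x. f x / L)"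
    using f L by (auto simp: config_lipschitz_def diff_divide_distrib[symmetric] field_simps)
  have "\<bar>integral\<^sup>L \<mu> (\<lambda>x. f x / L) - integral\<^sup>L \<nu> (\<lambda>x. f x / L)\<bar> \<le> transport_dist \<mu> \<nu>"
    unfolding transport_dist_eq
    by (rule cSUP_upper[where f = "\<lambda>f. \<bar>integral\<^sup>L \<mu> f - integral\<^sup>L \<nu> f\<bar>"])
      (use lip config_lipschitz_integral_diff_le[OF assms(1,2)] in \<open>auto intro!: bdd_aboveI2\<close>)
  then show ?thesis using L by (simp add: diff_divide_distrib[symmetric] field_simps)
qed

lemma transport_dist_le_total:
  fixes \<mu> \<nu> :: "('r::finite, 'a::finite) config measure"
  assumes "config_prob \<mu>" "config_prob \<nu>"
  shows "transport_dist \<mu> \<nu> \<le> total_weight TYPE('r)"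
  using assms by (intro transport_dist_leI config_lipschitz_integral_diff_le)

section \<open>Block codes\<close>

definition determined_by :: "'r free_group set \<Rightarrow> (('r, 'a) config \<Rightarrow> 'b) \<Rightarrow> bool" where
  "determined_by F f \<longleftrightarrow> (\<forall>x y. (\<forall>g\<in>F. x g = y g) \<longrightarrow> f x = f y)"

definition code :: "(('r, 'a) config \<Rightarrow> 'b) \<Rightarrow> ('r, 'a) config \<Rightarrow> ('r, 'b) config" where
  "code f x = (\<lambda>h. f (shift h x))"

lemma determined_byD: "determined_by F f \<Longrightarrow> (\<And>g. g \<in> F \<Longrightarrow> x g = y g) \<Longrightarrow> f x = f y"
  by (auto simp: determined_by_def)

lemma carrier_FG [simp]: "carrier FG = UNIV"
  by (simp add: FG_def)

lemma FG_one_mult [simp]: "\<one>\<^bsub>FG\<^esub> \<otimes>\<^bsub>FG\<^esub> g = g"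
  by (simp add: monoid.l_one group.is_monoid group_FG)

lemma inj_FG_mult: "inj (\<lambda>h. g \<otimes>\<^bsub>FG\<^esub> h)"
  using group.inj_on_cmult[OF group_FG, of g] by simp

text \<open>This is a Lipschitz constant for whatever reads the coordinates in the window \<open>F\<close> only:
  translating by \<open>g\<close> distorts the weights by a factor of at most \<open>1 / weight g\<close>.  The summand \<open>1\<close>
  makes it positive for the empty window, as it occurs in denominators.\<close>

definition window_constant :: "'r::finite free_group set \<Rightarrow> real" where
  "window_constant F = 1 + (\<Sum>g\<in>F. 1 / weight g)"

lemma window_constant_pos [simp]: "window_constant F > 0"
  unfolding window_constant_def by (intro add_pos_nonneg sum_nonneg) auto

lemma window_constant_nonneg [simp]: "window_constant F \<ge> 0"
  using window_constant_pos[of F] by linarith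

text \<open>If the images differ at \<open>h\<close>, then \<open>x\<close> and \<open>y\<close> differ at \<open>g \<otimes>\<^bsub>FG\<^esub> h\<close> for some \<open>g\<close> in the
  window; for each \<open>g\<close> the weights of these \<open>h\<close> are compared with those of the translates.\<close>

lemma config_dist_code_le:
  fixes f :: "('r::finite, 'a) config \<Rightarrow> 'b"
  assumes f: "determined_by F f" and F: "finite F"
  shows "config_dist (code f x) (code f y) \<le> window_constant F * config_dist x y"
proof (rule config_dist_leI)
  fix H :: "'r free_group set" assume H: "finite H"
  let ?a = "\<lambda>\<gamma>. of_bool (x \<gamma> \<noteq> y \<gamma>) :: real"
  have code: "of_bool (code f x h \<noteq> code f y h) \<le> (\<Sum>g\<in>F. ?a (g \<otimes>\<^bsub>FG\<^esub> h))" for h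
  proof (cases "code f x h = code f y h")
    case False
    then obtain g where g: "g \<in> F" "x (g \<otimes>\<^bsub>FG\<^esub> h) \<noteq> y (g \<otimes>\<^bsub>FG\<^esub> h)"
      using determined_byD[OF f, of "shift h x" "shift h y"] by (auto simp: code_def shift_def)
    have "of_bool (code f x h \<noteq> code f y h) \<le> ?a (g \<otimes>\<^bsub>FG\<^esub> h)" using g by simp
    also have "\<dots> \<le> (\<Sum>g\<in>F. ?a (g \<otimes>\<^bsub>FG\<^esub> h))" using g F by (intro member_le_sum) auto
    finally show ?thesis .
  qed (simp add: sum_nonneg)
  have move: "(\<Sum>h\<in>H. ?a (g \<otimes>\<^bsub>FG\<^esub> h) * weight h) \<le> 1 / weight g * config_dist x y" for g
  proof -
    have "(\<Sum>h\<in>H. ?a (g \<otimes>\<^bsub>FG\<^esub> h) * weight h)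
        \<le> (\<Sum>h\<in>H. 1 / weight g * (?a (g \<otimes>\<^bsub>FG\<^esub> h) * weight (g \<otimes>\<^bsub>FG\<^esub> h)))"
      using weight_mult[of g] by (intro sum_mono) (auto simp: field_simps)
    also have "\<dots> = 1 / weight g * (\<Sum>k\<in>(\<lambda>h. g \<otimes>\<^bsub>FG\<^esub> h) ` H. ?a k * weight k)"
      by (subst sum.reindex) (auto simp: sum_distrib_left intro: inj_on_subset[OF inj_FG_mult])
    also have "\<dots> \<le> 1 / weight g * config_dist x y"
      using H by (intro mult_left_mono sum_le_config_dist) auto
    finally show ?thesis .
  qed
  have "(\<Sum>h\<in>H. of_bool (code f x h \<noteq> code f y h) * weight h)
      \<le> (\<Sum>h\<in>H. (\<Sum>g\<in>F. ?a (g \<otimes>\<^bsub>FG\<^esub> h)) * weight h)"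
    by (intro sum_mono mult_right_mono code) auto
  also have "\<dots> = (\<Sum>g\<in>F. \<Sum>h\<in>H. ?a (g \<otimes>\<^bsub>FG\<^esub> h) * weight h)"
    by (subst sum.swap) (simp add: sum_distrib_right)
  also have "\<dots> \<le> (\<Sum>g\<in>F. 1 / weight g * config_dist x y)" by (intro sum_mono move)
  also have "\<dots> = (\<Sum>g\<in>F. 1 / weight g) * config_dist x y" by (simp add: sum_distrib_right)
  also have "\<dots> \<le> window_constant F * config_dist x y"
    unfolding window_constant_def by (intro mult_right_mono config_dist_nonneg) auto
  finally show "(\<Sum>h\<in>H. of_bool (code f x h \<noteq> code f y h) * weight h)
      \<le> window_constant F * config_dist x y" .
qed

lemma config_lipschitz_code:
  assumes "determined_by F f" "finite F" "config_lipschitz 1 u"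
  shows "config_lipschitz (window_constant F) (\<lambda>x. u (code f x))"
  unfolding config_lipschitz_def
proof (intro allI)
  fix x y
  have "\<bar>u (code f x) - u (code f y)\<bar> \<le> config_dist (code f x) (code f y)"
    using config_lipschitzD[OF assms(3)] by simp
  also have "\<dots> \<le> window_constant F * config_dist x y" by (rule config_dist_code_le[OF assms(1,2)])
  finally show "\<bar>u (code f x) - u (code f y)\<bar> \<le> window_constant F * config_dist x y" .
qed

text \<open>Configurations that differ at some \<open>g\<close> in the window are at distance at least \<open>weight g\<close>.  So
  closeness in the transportation metric controls the probability of local events.\<close>

lemma config_lipschitz_determined_event:
  fixes Q :: "('r::finite, 'a) config \<Rightarrow> bool"
  assumes Q: "determined_by F Q" and F: "finite F"
  shows "config_lipschitz (window_constant F) (\<lambda>x. of_bool (Q x))"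
  unfolding config_lipschitz_def
proof (intro allI)
  fix x y :: "('r, 'a) config"
  have nonneg: "0 \<le> window_constant F * config_dist x y" by (simp add: config_dist_nonneg)
  show "\<bar>of_bool (Q x) - of_bool (Q y)\<bar> \<le> window_constant F * config_dist x y"
  proof (cases "\<forall>g\<in>F. x g = y g")
    case True
    then show ?thesis using determined_byD[OF Q, of x y] nonneg by simp
  next
    case False
    then obtain g where g: "g \<in> F" "x g \<noteq> y g" by blast
    have "1 / weight g \<le> window_constant F"
      unfolding window_constant_def using g F
      by (intro order_trans[OF member_le_sum[of g F "\<lambda>g. 1 / weight g"]]) auto
    moreover have "weight g \<le> config_dist x y" using sum_le_config_dist[of "{g}" x y] g by simp
    ultimately have "1 / weight g * weight g \<le> window_constant F * config_dist x y"
      by (intro mult_mono) auto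
    then show ?thesis using weight_pos[of g] by (auto simp: less_imp_neq[symmetric])
  qed
qed

lemma measurable_determined_by:
  fixes f :: "('r, 'a::finite) config \<Rightarrow> 'b"
  assumes f: "determined_by F f" and F: "finite F"
  shows "f \<in> measurable config_borel (count_space UNIV)"
proof -
  let ?ext = "\<lambda>y g. if g \<in> F then y g else undefined"
  have "(\<lambda>x. restrict x F) \<in> measurable config_borel (Pi\<^sub>M F (\<lambda>_. count_space (UNIV :: 'a set)))"
    unfolding config_borel_def by (rule measurable_restrict_subset) simp
  also have "Pi\<^sub>M F (\<lambda>_. count_space (UNIV :: 'a set)) = count_space (F \<rightarrow>\<^sub>E UNIV)"
    using F by (intro count_space_PiM_finite) auto
  finally have "(\<lambda>x. f (restrict x F)) \<in> measurable config_borel (count_space UNIV)"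
    by (rule measurable_compose) simp
  also have "(\<lambda>x. f (restrict x F)) = f" by (auto intro!: determined_byD[OF f])
  finally show ?thesis .
qed

lemma measurable_coordinate [measurable]:
  "(\<lambda>x. x g) \<in> measurable config_borel (count_space (UNIV :: 'a set))"
  unfolding config_borel_def by (rule measurable_component_singleton) simp

lemma measurable_config:
  "(\<And>g. (\<lambda>z. T z g) \<in> measurable M (count_space UNIV)) \<Longrightarrow> T \<in> measurable M config_borel"
  unfolding config_borel_def by (rule measurable_abs_UNIV)

lemma measurable_shift [measurable]: "shift g \<in> measurable config_borel config_borel"
  by (rule measurable_config) (simp add: shift_def measurable_coordinate)

lemma measurable_code:
  assumes "f \<in> measurable config_borel (count_space UNIV)"
  shows "code f \<in> measurable config_borel config_borel"
  by (rule measurable_config)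
    (simp add: code_def measurable_compose[OF measurable_shift assms])

section \<open>Approximation by block codes\<close>

text \<open>The sets that finitely many coordinates approximate in measure form a \<open>\<sigma>\<close>-algebra that
  contains the cylinders.\<close>

lemma (in config_prob) approximate_by_cylinder:
  assumes "D \<in> sets config_borel" and "\<kappa> > 0"
  shows "\<exists>F (Q :: ('r, 'a) config \<Rightarrow> bool). finite F \<and> determined_by F Q \<and> measure \<mu> {x. (x \<in> D) \<noteq> Q x} < \<kappa>"
proof -
  have meas: "{x. (x \<in> D) \<noteq> Q x} \<in> sets \<mu>"
    if "D \<in> sets config_borel" "determined_by F Q" "finite F"
    for D and F and Q :: "('r, 'a) config \<Rightarrow> bool"
  proof -
    have "{x \<in> space \<mu>. Q x} \<in> sets \<mu>"
      using measurable_determined_by[OF that(2,3)] sets_eq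
      by (metis measurable_cong_sets pred_def)
    moreover have "D \<in> sets \<mu>" using that sets_eq by simp
    moreover have "{x. (x \<in> D) \<noteq> Q x} = (D - {x \<in> space \<mu>. Q x}) \<union> ({x \<in> space \<mu>. Q x} - D)"
      by (auto simp: space_eq)
    ultimately show ?thesis by auto
  qed
  let ?C = "{f :: ('r, 'a) config set. \<exists>i A. f = {x. x i \<in> A}}"
  have gen: "sets (config_borel :: ('r, 'a) config measure) = sigma_sets UNIV ?C"
    unfolding config_borel_def sets_PiM_single by (simp add: PiE_UNIV_domain)
  show ?thesis
    using assms unfolding gen
  proof (induction arbitrary: \<kappa>)
    case (Basic D)
    then obtain i A where "D = {x. x i \<in> A}" by blast
    then show ?case using Basic(2)
      by (intro exI[of _ "{i}"] exI[of _ "\<lambda>x. x i \<in> A"]) (auto simp: determined_by_def)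
  next
    case Empty
    then show ?case by (intro exI[of _ "{}"] exI[of _ "\<lambda>_. False"]) (auto simp: determined_by_def)
  next
    case (Compl D)
    then obtain F Q where "finite F" "determined_by F Q" "measure \<mu> {x. (x \<in> D) \<noteq> Q x} < \<kappa>" by blast
    moreover have "{x. (x \<in> UNIV - D) \<noteq> (\<not> Q x)} = {x. (x \<in> D) \<noteq> Q x}" by auto
    ultimately show ?case
      by (intro exI[of _ F] exI[of _ "\<lambda>x. \<not> Q x"]) (auto simp: determined_by_def)
  next
    case (Union D)
    have D: "D i \<in> sets \<mu>" for i using Union(1) gen sets_eq by auto
    let ?U = "\<Union>i. D i"
    have "(\<lambda>n. measure \<mu> (\<Union>i<n. D i)) \<longlonglongrightarrow> measure \<mu> (\<Union>n. \<Union>i<n. D i)"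
      by (rule finite_Lim_measure_incseq) (use D in \<open>auto simp: incseq_def, meson lessThan_iff less_le_trans\<close>)
    moreover have "(\<Union>n. \<Union>i<n. D i) = ?U" by auto
    ultimately have "(\<lambda>n. measure \<mu> (\<Union>i<n. D i)) \<longlonglongrightarrow> measure \<mu> ?U" by simp
    then have "\<forall>\<^sub>F n in sequentially. dist (measure \<mu> (\<Union>i<n. D i)) (measure \<mu> ?U) < \<kappa> / 2"
      by (rule tendstoD) (use Union in simp)
    then obtain n where n: "measure \<mu> ?U - measure \<mu> (\<Union>i<n. D i) < \<kappa> / 2"
      by (auto simp: eventually_sequentially dist_real_def abs_less_iff) (smt (verit) le_refl)
    have "\<forall>i. \<exists>F Q. finite F \<and> determined_by F Q \<and>
        measure \<mu> {x. (x \<in> D i) \<noteq> Q x} < \<kappa> / (2 * real (Suc n))"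
      using Union(2,3) by simp
    then have "\<exists>F Q. \<forall>i. finite (F i) \<and> determined_by (F i) (Q i) \<and>
        measure \<mu> {x. (x \<in> D i) \<noteq> Q i x} < \<kappa> / (2 * real (Suc n))"
      by (simp only: choice_iff)
    then obtain F Q where FQ: "\<And>i. finite (F i)" "\<And>i. determined_by (F i) (Q i)"
      "\<And>i. measure \<mu> {x. (x \<in> D i) \<noteq> Q i x} < \<kappa> / (2 * real (Suc n))"
      by blast
    let ?Q = "\<lambda>x. \<exists>i<n. Q i x"
    have det: "determined_by (\<Union>i<n. F i) ?Q"
      using FQ(2) unfolding determined_by_def by (metis UN_I lessThan_iff)
    let ?E = "\<lambda>i. {x. (x \<in> D i) \<noteq> Q i x}"
    have E: "?E i \<in> sets \<mu>" for i using meas[OF _ FQ(2,1)] D sets_eq by auto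
    have "measure \<mu> {x. (x \<in> ?U) \<noteq> ?Q x} \<le> measure \<mu> ((?U - (\<Union>i<n. D i)) \<union> (\<Union>i<n. ?E i))"
      using D E by (intro finite_measure_mono) auto
    also have "\<dots> \<le> measure \<mu> (?U - (\<Union>i<n. D i)) + measure \<mu> (\<Union>i<n. ?E i)"
      using D E by (intro measure_Un_le) auto
    also have "measure \<mu> (?U - (\<Union>i<n. D i)) = measure \<mu> ?U - measure \<mu> (\<Union>i<n. D i)"
      using D by (intro finite_measure_Diff) auto
    also have "measure \<mu> (\<Union>i<n. ?E i) \<le> (\<Sum>i<n. measure \<mu> (?E i))"
      using E by (intro finite_measure_subadditive_finite) auto
    also have "\<dots> \<le> (\<Sum>i<n. \<kappa> / (2 * real (Suc n)))" using FQ(3) by (intro sum_mono less_imp_le)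
    also have "\<dots> \<le> \<kappa> / 2" using Union(3) by (simp add: field_simps)
    finally have "measure \<mu> {x. (x \<in> ?U) \<noteq> ?Q x} < \<kappa>" using n by simp
    then show ?case using FQ(1) det by (intro exI[of _ "\<Union>i<n. F i"] exI[of _ ?Q]) auto
  qed
qed

lemma (in config_prob) approximate_by_block_code:
  fixes q :: "('r, 'a) config \<Rightarrow> 'b::finite"
  assumes q: "q \<in> measurable config_borel (count_space UNIV)" and "\<kappa> > 0"
  shows "\<exists>F f. finite F \<and> determined_by F f \<and> measure \<mu> {x. f x \<noteq> q x} < \<kappa>"
proof -
  let ?\<kappa> = "\<kappa> / real (CARD('b))"
  have pos: "?\<kappa> > 0" using assms(2) by simp
  have lev: "{x. q x = b} \<in> sets config_borel" for b
    using measurable_sets[OF q, of "{b}"] by (simp add: vimage_def)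
  have "\<forall>b. \<exists>F Q. finite F \<and> determined_by F Q \<and> measure \<mu> {x. (q x = b) \<noteq> Q x} < ?\<kappa>"
    using approximate_by_cylinder[OF lev pos] by simp
  then have "\<exists>F Q. \<forall>b. finite (F b) \<and> determined_by (F b) (Q b) \<and> measure \<mu> {x. (q x = b) \<noteq> Q b x} < ?\<kappa>"
    by (simp only: choice_iff)
  then obtain F Q where FQ: "\<And>b. finite (F b)" "\<And>b. determined_by (F b) (Q b)"
    "\<And>b. measure \<mu> {x. (q x = b) \<noteq> Q b x} < ?\<kappa>"
    by blast
  define f where "f x = (SOME b. Q b x)" for x
  have det: "determined_by (\<Union>b. F b) f"
    unfolding determined_by_def
  proof (intro allI impI)
    fix x y :: "('r, 'a) config" assume *: "\<forall>g\<in>\<Union>b. F b. x g = y g"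
    have "Q b x = Q b y" for b by (rule determined_byD[OF FQ(2)]) (use * in auto)
    then show "f x = f y" by (simp add: f_def)
  qed
  let ?E = "\<lambda>b. {x. (q x = b) \<noteq> Q b x}"
  have E: "?E b \<in> sets \<mu>" for b
  proof -
    have "{x. Q b x} \<in> sets config_borel" 
      using measurable_sets[OF measurable_determined_by[OF FQ(2,1)], of "{True}"] by (simp add: vimage_def)
    then have "({x. q x = b} - {x. Q b x}) \<union> ({x. Q b x} - {x. q x = b}) \<in> sets \<mu>"
      using lev[of b] sets_eq by auto
    also have "({x. q x = b} - {x. Q b x}) \<union> ({x. Q b x} - {x. q x = b}) = ?E b" by auto
    finally show ?thesis .
  qed
  \<comment> \<open>Off the exceptional sets exactly one \<open>Q b\<close> holds at \<open>x\<close>, so the choice in \<open>f\<close> is forced.\<close>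
  have "f x = q x" if "x \<notin> (\<Union>b. ?E b)" for x
  proof -
    have "(q x = b) = Q b x" for b using that by blast
    then have "f x = (SOME b. q x = b)" by (simp add: f_def)
    then show ?thesis by simp
  qed
  then have "{x. f x \<noteq> q x} \<subseteq> (\<Union>b. ?E b)" by blast
  then have "measure \<mu> {x. f x \<noteq> q x} \<le> measure \<mu> (\<Union>b. ?E b)"
    using E by (intro finite_measure_mono sets.finite_UN) auto
  also have "\<dots> \<le> (\<Sum>b\<in>UNIV. measure \<mu> (?E b))"
    using E by (intro finite_measure_subadditive_finite) auto
  also have "\<dots> < (\<Sum>b\<in>(UNIV :: 'b set). ?\<kappa>)" using FQ(3) by (intro sum_strict_mono) auto
  also have "\<dots> = \<kappa>" by simp
  finally show ?thesis using FQ(1) det by (intro exI[of _ "\<Union>b. F b"] exI[of _ f]) auto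
qed

section \<open>Block codes acting on models\<close>

lemma perm_homs_in:
  assumes "\<sigma> \<in> perm_homs V" and "v \<in> V"
  shows "\<sigma> g v \<in> V"
proof -
  have "\<sigma> g \<in> carrier (BijGroup V)"
    using assms(1) unfolding perm_homs_def by (rule hom_in_carrier) simp
  then show ?thesis using assms(2) by (auto simp: BijGroup_def Bij_def bij_betw_def)
qed

lemma perm_homs_mult:
  assumes \<sigma>: "\<sigma> \<in> perm_homs V" and "v \<in> V"
  shows "\<sigma> (g \<otimes>\<^bsub>FG\<^esub> h) v = \<sigma> g (\<sigma> h v)"
proof -
  have Bij: "\<sigma> k \<in> Bij V" for k
    using hom_in_carrier[of \<sigma> FG "BijGroup V" k] \<sigma> by (simp add: perm_homs_def BijGroup_def)
  have "\<sigma> (g \<otimes>\<^bsub>FG\<^esub> h) = \<sigma> g \<otimes>\<^bsub>BijGroup V\<^esub> \<sigma> h"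
    using \<sigma> by (intro hom_mult) (auto simp: perm_homs_def)
  then show ?thesis using Bij assms(2) by (simp add: BijGroup_def compose_def)
qed

lemma perm_homs_one:
  assumes "\<sigma> \<in> perm_homs V" and "v \<in> V"
  shows "\<sigma> \<one>\<^bsub>FG\<^esub> v = v"
proof -
  have "\<sigma> \<one>\<^bsub>FG\<^esub> = \<one>\<^bsub>BijGroup V\<^esub>"
    using assms(1) by (intro hom_one group_FG group_BijGroup) (simp add: perm_homs_def)
  then show ?thesis using assms(2) by (simp add: BijGroup_def)
qed

lemma config_prob_empirical:
  fixes x :: "'v \<Rightarrow> 'a::finite" and \<sigma> :: "'r::finite free_group \<Rightarrow> 'v \<Rightarrow> 'v"
  assumes "finite V" "V \<noteq> {}"
  shows "config_prob (empirical_distribution V \<sigma> x)"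
proof -
  interpret U: prob_space "uniform_count_measure V" by (rule prob_space_uniform_count_measure[OF assms])
  have "prob_space (empirical_distribution V \<sigma> x)"
    unfolding empirical_distribution_def
    by (intro U.prob_space_distr) (auto simp: measurable_def space_uniform_count_measure sets_uniform_count_measure)
  then show ?thesis
    by (simp add: config_prob_def config_prob_axioms_def empirical_distribution_def)
qed

lemma integral_empirical_distribution:
  fixes u :: "('r::finite, 'a::finite) config \<Rightarrow> real"
  assumes V: "finite V" "V \<noteq> {}" and u: "u \<in> borel_measurable config_borel"
  shows "integral\<^sup>L (empirical_distribution V \<sigma> x) u = (\<Sum>v\<in>V. u (pullback_name \<sigma> x v)) / real (card V)"
proof -
  have "pullback_name \<sigma> x \<in> measurable (uniform_count_measure V) config_borel"
    by (auto simp: measurable_def space_uniform_count_measure sets_uniform_count_measure)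
  then have "integral\<^sup>L (empirical_distribution V \<sigma> x) u
      = (LINT v|uniform_count_measure V. u (pullback_name \<sigma> x v))"
    unfolding empirical_distribution_def using u by (intro integral_distr) auto
  also have "\<dots> = (\<Sum>v\<in>V. u (pullback_name \<sigma> x v)) / real (card V)"
    unfolding uniform_count_measure_def using V
    by (subst lebesgue_integral_point_measure_finite) (auto simp: sum_divide_distrib)
  finally show ?thesis .
qed

definition apply_code ::
    "'v set \<Rightarrow> ('r free_group \<Rightarrow> 'v \<Rightarrow> 'v) \<Rightarrow> (('r, 'a) config \<Rightarrow> 'b) \<Rightarrow> ('v \<Rightarrow> 'a) \<Rightarrow> 'v \<Rightarrow> 'b" where
  "apply_code V \<sigma> f x = restrict (\<lambda>v. f (pullback_name \<sigma> x v)) V"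

text \<open>Since \<open>\<sigma>\<close> is a genuine homomorphism, a block code acts on models and on configurations
  compatibly, without error.\<close>

lemma pullback_apply_code:
  assumes \<sigma>: "\<sigma> \<in> perm_homs V" and v: "v \<in> V"
  shows "pullback_name \<sigma> (apply_code V \<sigma> f x) v = code f (pullback_name \<sigma> x v)"
proof
  fix h
  have "pullback_name \<sigma> x (\<sigma> h v) = shift h (pullback_name \<sigma> x v)"
    using perm_homs_mult[OF \<sigma> v] by (simp add: pullback_name_def shift_def)
  moreover have "pullback_name \<sigma> (apply_code V \<sigma> f x) v h = f (pullback_name \<sigma> x (\<sigma> h v))"
    using perm_homs_in[OF \<sigma> v, of h] by (simp add: pullback_name_def apply_code_def)
  ultimately show "pullback_name \<sigma> (apply_code V \<sigma> f x) v h = code f (pullback_name \<sigma> x v) h"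
    by (simp add: code_def)
qed

lemma config_prob_distr:
  assumes "config_prob \<mu>" and "T \<in> measurable config_borel config_borel"
  shows "config_prob (distr \<mu> config_borel T)"
proof -
  interpret config_prob \<mu> by fact
  have "T \<in> measurable \<mu> config_borel" using assms(2) sets_eq by (simp cong: measurable_cong_sets)
  then show ?thesis by (simp add: config_prob_def config_prob_axioms_def prob_space_distr)
qed

lemma (in config_prob) integral_distr_config:
  fixes u :: "('s::finite, 'b::finite) config \<Rightarrow> real"
  assumes "T \<in> measurable config_borel config_borel" and "u \<in> borel_measurable config_borel"
  shows "integral\<^sup>L (distr \<mu> config_borel T) u = (LINT x|\<mu>. u (T x))"
  using assms by (intro integral_distr) (simp_all cong: measurable_cong_sets add: sets_eq)

lemma transport_dist_apply_code_le:
  fixes \<mu> :: "('r::finite, 'a::finite) config measure" and \<nu> :: "('r, 'b::finite) config measure"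
    and x :: "'v \<Rightarrow> 'a"
  assumes V: "finite V" "V \<noteq> {}" and \<sigma>: "\<sigma> \<in> perm_homs V"
    and \<mu>: "config_prob \<mu>" and \<nu>: "config_prob \<nu>" and f: "determined_by F f" "finite F"
  shows "transport_dist (empirical_distribution V \<sigma> (apply_code V \<sigma> f x)) \<nu>
    \<le> window_constant F * transport_dist (empirical_distribution V \<sigma> x) \<mu>
      + transport_dist (distr \<mu> config_borel (code f)) \<nu>"
proof (rule transport_dist_leI)
  fix u :: "('r, 'b) config \<Rightarrow> real" assume u: "config_lipschitz 1 u"
  interpret \<mu>: config_prob \<mu> by (rule \<mu>)
  note code = measurable_code[OF measurable_determined_by[OF f]]
  have um: "u \<in> borel_measurable config_borel" by (rule borel_measurable_config_lipschitz[OF u]) simp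
  have ucm: "(\<lambda>z. u (code f z)) \<in> borel_measurable config_borel" by (rule measurable_compose[OF code um])
  let ?I = "integral\<^sup>L (empirical_distribution V \<sigma> (apply_code V \<sigma> f x)) u"
  have "?I = (\<Sum>v\<in>V. u (code f (pullback_name \<sigma> x v))) / real (card V)"
    by (simp add: integral_empirical_distribution[OF V um] pullback_apply_code[OF \<sigma>])
  also have "\<dots> = integral\<^sup>L (empirical_distribution V \<sigma> x) (\<lambda>z. u (code f z))"
    by (simp add: integral_empirical_distribution[OF V ucm])
  finally have "\<bar>?I - (LINT z|\<mu>. u (code f z))\<bar>
      \<le> window_constant F * transport_dist (empirical_distribution V \<sigma> x) \<mu>"
    using integral_diff_le_transport_dist[OF config_prob_empirical[OF V] \<mu> config_lipschitz_code[OF f u]]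
    by simp
  moreover have "\<bar>(LINT z|\<mu>. u (code f z)) - integral\<^sup>L \<nu> u\<bar>
      \<le> transport_dist (distr \<mu> config_borel (code f)) \<nu>"
    using integral_diff_le_transport_dist[OF config_prob_distr[OF \<mu> code] \<nu> u]
    by (simp add: \<mu>.integral_distr_config[OF code um])
  ultimately show "\<bar>?I - integral\<^sup>L \<nu> u\<bar>
      \<le> window_constant F * transport_dist (empirical_distribution V \<sigma> x) \<mu>
        + transport_dist (distr \<mu> config_borel (code f)) \<nu>"
    by linarith
qed

lemma (in config_prob) sets_neq:
  fixes p q :: "('r, 'a) config \<Rightarrow> 'b::finite"
  assumes "p \<in> measurable config_borel (count_space UNIV)" "q \<in> measurable config_borel (count_space UNIV)"
  shows "{x. p x \<noteq> q x} \<in> sets \<mu>"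
proof -
  have "{x. p x \<noteq> q x} = (\<Union>b. {x. p x = b} - {x. q x = b})" by auto
  moreover have "{x. p x = b} \<in> sets \<mu>" "{x. q x = b} \<in> sets \<mu>" for b
    using measurable_sets[OF assms(1), of "{b}"] measurable_sets[OF assms(2), of "{b}"] sets_eq
    by (auto simp: vimage_def)
  ultimately show ?thesis by auto
qed

text \<open>Pushing \<open>\<mu>\<close> forward under two maps that rarely disagree at any single coordinate gives
  close measures, as the joint law of the two images is a coupling.\<close>

lemma (in config_prob) transport_dist_distr_le:
  fixes S T :: "('r, 'a) config \<Rightarrow> ('r, 'b::finite) config"
  assumes S: "S \<in> measurable config_borel config_borel" and T: "T \<in> measurable config_borel config_borel"
    and \<kappa>: "\<And>h. measure \<mu> {x. S x h \<noteq> T x h} \<le> \<kappa>"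
  shows "transport_dist (distr \<mu> config_borel S) (distr \<mu> config_borel T) \<le> \<kappa> * total_weight TYPE('r)"
proof (rule transport_dist_leI)
  fix u :: "('r, 'b) config \<Rightarrow> real" assume u: "config_lipschitz 1 u"
  have um: "u \<in> borel_measurable config_borel" by (rule borel_measurable_config_lipschitz[OF u]) simp
  have int: "integrable \<mu> (\<lambda>x. u (R x))" if R: "R \<in> measurable config_borel config_borel" for R
  proof (rule integrable_const_bound)
    have "\<bar>u (R x)\<bar> \<le> \<bar>u undefined\<bar> + total_weight TYPE('r)" for x
      using config_lipschitz_bounded[OF u, of "R x" undefined] by simp
    then show "AE x in \<mu>. norm (u (R x)) \<le> \<bar>u undefined\<bar> + total_weight TYPE('r)" by simp
    show "(\<lambda>x. u (R x)) \<in> borel_measurable \<mu>"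
      using measurable_compose[OF R um] sets_eq by (simp cong: measurable_cong_sets)
  qed
  have \<kappa>0: "\<kappa> \<ge> 0" using \<kappa>[of undefined] measure_nonneg[of \<mu>] by (rule order_trans[rotated])
  have E: "{x. S x h \<noteq> T x h} \<in> sets \<mu>" for h
    by (rule sets_neq) (use measurable_compose[OF S measurable_coordinate] measurable_compose[OF T measurable_coordinate] in auto)
  have "\<bar>(LINT x|\<mu>. u (S x)) - (LINT x|\<mu>. u (T x))\<bar> \<le> \<kappa> * total_weight TYPE('r)"
  proof (rule field_le_epsilon)
    fix \<tau> :: real assume "\<tau> > 0"
    then obtain G :: "'r free_group set" where G: "finite G"
      "\<And>x y :: ('r, 'b) config. config_dist x y \<le> (\<Sum>\<gamma>\<in>G. of_bool (x \<gamma> \<noteq> y \<gamma>) * weight \<gamma>) + \<tau>"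
      using config_dist_truncate by blast
    let ?d = "\<lambda>x. (\<Sum>\<gamma>\<in>G. indicator {x. S x \<gamma> \<noteq> T x \<gamma>} x * weight \<gamma>) + \<tau>"
    have intI: "integrable \<mu> (\<lambda>x. indicator {x. S x h \<noteq> T x h} x * weight h)" for h
      using E by (intro integrable_mult_left integrable_real_indicator) (auto simp: emeasure_eq_measure)
    have le: "\<bar>u (S x) - u (T x)\<bar> \<le> ?d x" for x
    proof -
      have "\<bar>u (S x) - u (T x)\<bar> \<le> config_dist (S x) (T x)"
        using config_lipschitzD[OF u, of "S x" "T x"] by simp
      also have "\<dots> \<le> (\<Sum>\<gamma>\<in>G. of_bool (S x \<gamma> \<noteq> T x \<gamma>) * weight \<gamma>) + \<tau>" by (rule G(2))
      also have "\<dots> = ?d x" by (simp add: indicator_def)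
      finally show ?thesis .
    qed
    have "\<bar>(LINT x|\<mu>. u (S x)) - (LINT x|\<mu>. u (T x))\<bar> = \<bar>LINT x|\<mu>. u (S x) - u (T x)\<bar>"
      using int[OF S] int[OF T] by simp
    also have "\<dots> \<le> (LINT x|\<mu>. \<bar>u (S x) - u (T x)\<bar>)" by (rule integral_abs_bound)
    also have "\<dots> \<le> (LINT x|\<mu>. ?d x)"
      using int[OF S] int[OF T] intI le by (intro integral_mono) auto
    also have "\<dots> = (\<Sum>h\<in>G. measure \<mu> {x. S x h \<noteq> T x h} * weight h) + \<tau>"
      using intI E by (simp add: Bochner_Integration.integral_sum prob_space[unfolded space_eq] space_eq)
    also have "(\<Sum>h\<in>G. measure \<mu> {x. S x h \<noteq> T x h} * weight h) \<le> (\<Sum>h\<in>G. \<kappa> * weight h)"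
      by (intro sum_mono mult_right_mono \<kappa>) auto
    also have "\<dots> \<le> \<kappa> * total_weight TYPE('r)"
      unfolding sum_distrib_left[symmetric] by (intro mult_left_mono sum_weight_le G \<kappa>0)
    finally show "\<bar>(LINT x|\<mu>. u (S x)) - (LINT x|\<mu>. u (T x))\<bar> \<le> \<kappa> * total_weight TYPE('r) + \<tau>"
      by simp
  qed
  then show "\<bar>integral\<^sup>L (distr \<mu> config_borel S) u - integral\<^sup>L (distr \<mu> config_borel T) u\<bar>
      \<le> \<kappa> * total_weight TYPE('r)"
    by (simp add: integral_distr_config[OF S um] integral_distr_config[OF T um])
qed

section \<open>Counting models\<close>

text \<open>A Chernoff bound: under the weight \<open>z\<close> per disagreement with \<open>y\<close>, all of \<open>A\<^sup>V\<close> has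
  total weight \<open>(1 + (|A| - 1) * z)^|V|\<close>, and each point of the ball has weight at least
  \<open>z\<close> to the power \<open>\<delta> * |V|\<close>.\<close>

lemma hamming_ball_card_le:
  assumes "\<eta> > 0"
  shows "\<exists>\<delta>>0. \<forall>V :: 'v set. \<forall>y :: 'v \<Rightarrow> 'a::finite. finite V \<longrightarrow>
    real (card {x \<in> V \<rightarrow>\<^sub>E UNIV. real (card {v \<in> V. x v \<noteq> y v}) \<le> \<delta> * real (card V)})
      \<le> exp (\<eta> * real (card V))"
proof -
  \<comment> \<open>The choice of \<open>z\<close> keeps the total weight below \<open>exp (\<eta> / 2 * |V|)\<close>, and the choice of \<open>\<delta>\<close> keeps the
    weight of each point of the ball above \<open>exp (- \<eta> / 2 * |V|)\<close>.\<close>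
  define z where "z = min 1 (\<eta> / (2 * real CARD('a)))"
  have z: "0 < z" "z \<le> 1" using assms by (auto simp: z_def)
  have "real CARD('a) * z \<le> real CARD('a) * (\<eta> / (2 * real CARD('a)))"
    by (intro mult_left_mono) (auto simp: z_def)
  also have "\<dots> = \<eta> / 2" by simp
  finally have zA: "real CARD('a) * z \<le> \<eta> / 2" .
  define l where "l = - ln z"
  have l: "l \<ge> 0" using z by (simp add: l_def)
  define \<delta> where "\<delta> = \<eta> / (2 * (1 + l))"
  have \<delta>: "\<delta> > 0" using assms l by (simp add: \<delta>_def)
  have "\<delta> * l \<le> \<delta> * (1 + l)" using \<delta> by simp
  also have "\<dots> = \<eta> / 2" using l by (simp add: \<delta>_def field_simps)
  finally have \<delta>l: "\<delta> * l \<le> \<eta> / 2" .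
  have "real (card {x \<in> V \<rightarrow>\<^sub>E UNIV. real (card {v \<in> V. x v \<noteq> y v}) \<le> \<delta> * real (card V)})
      \<le> exp (\<eta> * real (card V))" if V: "finite V" for V :: "'v set" and y :: "'v \<Rightarrow> 'a"
  proof -
    let ?n = "real (card V)"
    let ?B = "{x \<in> V \<rightarrow>\<^sub>E UNIV. real (card {v \<in> V. x v \<noteq> y v}) \<le> \<delta> * ?n}"
    let ?p = "\<lambda>x :: 'v \<Rightarrow> 'a. \<Prod>v\<in>V. if x v = y v then 1 else z"
    have finB: "finite (V \<rightarrow>\<^sub>E (UNIV :: 'a set))" using V by (intro finite_PiE) auto
    have low: "exp (- (\<eta> / 2 * ?n)) \<le> ?p x" if "x \<in> ?B" for x
    proof -
      let ?k = "card {v \<in> V. x v \<noteq> y v}"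
      have "?p x = z ^ ?k"
        using V by (simp add: prod.If_cases) (simp add: Int_def Collect_neg_eq[symmetric] conj_commute)
      also have "\<dots> = exp (- (real ?k * l))"
        using z by (simp add: l_def exp_of_nat_mult)
      finally have px: "?p x = exp (- (real ?k * l))" .
      have "real ?k * l \<le> \<delta> * ?n * l" using that l by (intro mult_right_mono) auto
      also have "\<dots> = \<delta> * l * ?n" by simp
      also have "\<dots> \<le> \<eta> / 2 * ?n" using \<delta>l by (intro mult_right_mono) auto
      finally show ?thesis unfolding px by simp
    qed
    have "real (card ?B) * exp (- (\<eta> / 2 * ?n)) \<le> (\<Sum>x\<in>?B. ?p x)"
      using sum_mono[of ?B "\<lambda>_. exp (- (\<eta> / 2 * ?n))" ?p] low by simp
    also have "\<dots> \<le> (\<Sum>x\<in>V \<rightarrow>\<^sub>E UNIV. ?p x)"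
      using finB z by (intro sum_mono2 prod_nonneg) auto
    also have "\<dots> = (\<Prod>v\<in>V. \<Sum>a\<in>UNIV. if a = y v then 1 else z)"
      using V by (subst prod_sum_PiE) auto
    also have "\<dots> \<le> (\<Prod>v\<in>V. exp (\<eta> / 2))"
    proof (rule prod_mono, intro conjI)
      fix v
      show "0 \<le> (\<Sum>a\<in>UNIV. if a = y v then 1 else z)" using z by (intro sum_nonneg) auto
      have "(\<Sum>a\<in>UNIV. if a = y v then 1 else z) \<le> (\<Sum>a\<in>UNIV. (if a = y v then 1 else 0) + z)"
        using z by (intro sum_mono) auto
      also have "\<dots> = 1 + real CARD('a) * z" by (simp add: sum.distrib)
      also have "\<dots> \<le> exp (real CARD('a) * z)" by (rule exp_ge_add_one_self)
      also have "\<dots> \<le> exp (\<eta> / 2)" using zA by simp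
      finally show "(\<Sum>a\<in>UNIV. if a = y v then 1 else z) \<le> exp (\<eta> / 2)" .
    qed
    also have "\<dots> = exp (\<eta> / 2 * ?n)" by (simp only: prod_constant exp_of_nat2_mult)
    finally have "real (card ?B) \<le> exp (\<eta> / 2 * ?n) / exp (- (\<eta> / 2 * ?n))" by (simp add: field_simps)
    also have "\<dots> = exp (\<eta> * ?n)" by (simp add: exp_diff[symmetric] field_simps)
    finally show ?thesis .
  qed
  then show ?thesis using \<delta> by blast
qed

lemma card_le_fibres:
  assumes A: "finite A" and B: "finite B" and f: "f ` A \<subseteq> B" and b: "b \<ge> 0"
    and fib: "\<And>y. y \<in> B \<Longrightarrow> real (card {x \<in> A. f x = y}) \<le> b"
  shows "real (card A) \<le> b * real (card B)"
proof -
  have "real (card A) = (\<Sum>y\<in>f ` A. real (card {x \<in> A. f x = y}))"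
    using sum.image_gen[OF A, of "\<lambda>_. 1 :: real" f] by simp
  also have "\<dots> \<le> (\<Sum>y\<in>f ` A. b)" using fib f by (intro sum_mono) auto
  also have "\<dots> = b * real (card (f ` A))" by simp
  also have "\<dots> \<le> b * real (card B)" using f B b by (intro mult_left_mono) (auto intro: card_mono)
  finally show ?thesis .
qed

section \<open>Transferring models along an isomorphism\<close>

lemma shift_invariant_probsD:
  fixes \<mu> :: "('r::finite, 'a::finite) config measure"
  assumes "\<mu> \<in> shift_invariant_probs"
  shows "config_prob \<mu>" and "distr \<mu> config_borel (shift g) = \<mu>"
  using assms by (auto simp: shift_invariant_probs_def config_prob_def config_prob_axioms_def)

lemma AE_distr_config:
  assumes "config_prob \<mu>" "T \<in> measurable config_borel config_borel"
    and "AE y in distr \<mu> config_borel T. R y"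
  shows "AE x in \<mu>. R (T x)"
proof -
  interpret config_prob \<mu> by fact
  have "T \<in> measurable \<mu> config_borel" using assms(2) sets_eq by (simp cong: measurable_cong_sets)
  then show ?thesis using assms(3) by (rule AE_distrD)
qed

text \<open>The point is the equivariance of \<open>\<psi>\<close> almost everywhere.  As \<open>\<nu>\<close> is the image of \<open>\<mu>\<close>, it may be
  checked at \<open>\<phi> x\<close>, where it follows from the equivariance of \<open>\<phi>\<close> because by invariance \<open>\<psi>\<close> also
  inverts \<open>\<phi>\<close> at almost every translate \<open>shift g x\<close>.\<close>

lemma isomorphic_systems_sym:
  fixes \<mu> :: "('r::finite, 'a::finite) config measure" and \<nu> :: "('r, 'b::finite) config measure"
  assumes \<mu>: "\<mu> \<in> shift_invariant_probs" and "isomorphic_systems \<mu> \<nu>"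
  shows "isomorphic_systems \<nu> \<mu>"
proof -
  interpret \<mu>: config_prob \<mu> by (rule shift_invariant_probsD[OF \<mu>])
  obtain \<phi> \<psi> where \<phi>: "\<phi> \<in> measurable config_borel config_borel"
    and \<psi>: "\<psi> \<in> measurable config_borel config_borel" and \<nu>: "distr \<mu> config_borel \<phi> = \<nu>"
    and \<psi>\<phi>: "AE x in \<mu>. \<psi> (\<phi> x) = x" and \<phi>\<psi>: "AE y in \<nu>. \<phi> (\<psi> y) = y"
    and equi: "\<And>g. AE x in \<mu>. \<phi> (shift g x) = shift g (\<phi> x)"
    using assms(2) unfolding isomorphic_systems_def by blast
  have m: "\<phi> \<in> measurable \<mu> config_borel"
    using \<phi> \<mu>.sets_eq by (simp cong: measurable_cong_sets)
  have "distr \<nu> config_borel \<psi> = distr \<mu> config_borel (\<psi> \<circ> \<phi>)"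
    unfolding \<nu>[symmetric] using \<psi> m by (rule distr_distr)
  also have "\<dots> = distr \<mu> config_borel (\<lambda>x. x)"
    using \<psi>\<phi> m \<psi> \<mu>.sets_eq
    by (intro distr_cong_AE) (auto intro: measurable_comp simp: measurable_ident_sets)
  also have "\<dots> = \<mu>" using \<mu>.sets_eq by (simp add: distr_id2)
  finally have inverse_distr: "distr \<nu> config_borel \<psi> = \<mu>" .
  have "AE y in \<nu>. \<psi> (shift g y) = shift g (\<psi> y)" for g
  proof -
    have "AE x in \<mu>. \<psi> (\<phi> (shift g x)) = shift g x"
      by (rule AE_distr_config[OF \<mu>.config_prob_axioms measurable_shift, of "\<lambda>x. \<psi> (\<phi> x) = x"])
        (subst shift_invariant_probsD(2)[OF \<mu>], rule \<psi>\<phi>)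
    with equi[of g] \<psi>\<phi> have "AE x in \<mu>. \<psi> (shift g (\<phi> x)) = shift g (\<psi> (\<phi> x))"
      by eventually_elim simp
    moreover have "{y \<in> space config_borel. \<psi> (shift g y) = shift g (\<psi> y)} \<in> sets config_borel"
    proof -
      have "{y. \<psi> (shift g y) = shift g (\<psi> y)} = (\<Inter>h. {y. \<psi> (shift g y) h = shift g (\<psi> y) h})"
        by (auto simp: fun_eq_iff)
      moreover have "{y. \<psi> (shift g y) h = shift g (\<psi> y) h} \<in> sets config_borel" for h
      proof -
        have [measurable]: "\<psi> \<in> measurable config_borel config_borel" by (rule \<psi>)
        have "{y \<in> space config_borel. \<psi> (shift g y) h = shift g (\<psi> y) h} \<in> sets config_borel"
          by measurable
        then show ?thesis by simp
      qed
      ultimately show ?thesis by (auto intro!: sets.countable_INT)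
    qed
    ultimately show ?thesis
      unfolding \<nu>[symmetric] by (subst AE_distr_iff[OF m]) auto
  qed
  then show ?thesis unfolding isomorphic_systems_def using \<phi> \<psi> \<phi>\<psi> \<psi>\<phi> inverse_distr by blast
qed

text \<open>By invariance of \<open>\<mu>\<close> and equivariance of \<open>\<phi>\<close>, an error bound at the identity holds at every
  group element.\<close>

lemma code_error_le:
  fixes \<mu> :: "('r::finite, 'a::finite) config measure" and \<phi> :: "('r, 'a) config \<Rightarrow> ('r, 'b::finite) config"
  assumes \<mu>: "\<mu> \<in> shift_invariant_probs" and \<phi>: "\<phi> \<in> measurable config_borel config_borel"
    and equi: "\<And>g. AE x in \<mu>. \<phi> (shift g x) = shift g (\<phi> x)"
    and f: "f \<in> measurable config_borel (count_space UNIV)"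
  shows "measure \<mu> {x. code f x h \<noteq> \<phi> x h} \<le> measure \<mu> {x. f x \<noteq> \<phi> x \<one>\<^bsub>FG\<^esub>}"
proof -
  interpret config_prob \<mu> by (rule shift_invariant_probsD[OF \<mu>])
  let ?E = "{x. f x \<noteq> \<phi> x \<one>\<^bsub>FG\<^esub>}"
  have E: "?E \<in> sets \<mu>"
    by (rule sets_neq[OF f]) (use measurable_compose[OF \<phi> measurable_coordinate] in simp)
  then have E': "?E \<in> sets config_borel" by (simp only: sets_eq)
  have sh: "shift h \<in> measurable \<mu> config_borel"
    using measurable_shift by (simp only: measurable_cong_sets[OF sets_eq refl])
  have "AE x in \<mu>. x \<in> {x. code f x h \<noteq> \<phi> x h} \<longrightarrow> x \<in> shift h -` ?E \<inter> space \<mu>"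
    using equi[of h]
  proof eventually_elim
    case (elim x)
    have "\<phi> (shift h x) \<one>\<^bsub>FG\<^esub> = \<phi> x h" unfolding elim by (simp add: shift_def)
    then show ?case by (simp add: code_def space_eq)
  qed
  then have "measure \<mu> {x. code f x h \<noteq> \<phi> x h} \<le> measure \<mu> (shift h -` ?E \<inter> space \<mu>)"
    by (rule finite_measure_mono_AE) (rule measurable_sets[OF sh E'])
  also have "\<dots> = measure (distr \<mu> config_borel (shift h)) ?E"
    by (rule measure_distr[OF sh E', symmetric])
  also have "distr \<mu> config_borel (shift h) = \<mu>" by (rule shift_invariant_probsD(2)[OF \<mu>])
  finally show ?thesis .
qed

lemma good_models_mono: "\<epsilon> \<le> \<epsilon>' \<Longrightarrow> good_models V \<sigma> \<mu> \<epsilon> \<subseteq> good_models V \<sigma> \<mu> \<epsilon>'"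
  by (auto simp: good_models_def)

lemma finite_good_models:
  "finite V \<Longrightarrow> finite (good_models V \<sigma> (\<mu> :: ('r::finite, 'a::finite) config measure) \<epsilon>)"
  by (rule finite_subset[of _ "V \<rightarrow>\<^sub>E UNIV"]) (auto simp: good_models_def intro: finite_PiE)

text \<open>A block code approximating \<open>\<phi>\<close> maps good models of \<open>\<mu>\<close> to good models of \<open>\<nu>\<close>, and a block code
  approximating \<open>\<psi>\<close> confines each of its fibres to a small Hamming ball.  The radius \<open>\<epsilon>\<close> depends on
  the windows of the codes only, hence neither on \<open>V\<close> nor on \<open>\<sigma>\<close>.\<close>

lemma card_good_models_transfer:
  fixes \<mu> :: "('r::finite, 'a::finite) config measure" and \<nu> :: "('r, 'b::finite) config measure"
  assumes \<mu>: "\<mu> \<in> shift_invariant_probs" and iso: "isomorphic_systems \<mu> \<nu>"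
    and \<eta>: "\<eta> > 0" and \<epsilon>': "\<epsilon>' > 0"
  shows "\<exists>\<epsilon>>0. \<forall>V :: 'v set. \<forall>\<sigma>. finite V \<and> V \<noteq> {} \<and> \<sigma> \<in> perm_homs V \<longrightarrow>
    real (card (good_models V \<sigma> \<mu> \<epsilon>)) \<le> exp (\<eta> * real (card V)) * real (card (good_models V \<sigma> \<nu> \<epsilon>'))"
proof -
  interpret \<mu>: config_prob \<mu> by (rule shift_invariant_probsD[OF \<mu>])
  obtain \<phi> \<psi> where \<phi>: "\<phi> \<in> measurable config_borel config_borel"
    and \<psi>: "\<psi> \<in> measurable config_borel config_borel" and \<nu>: "distr \<mu> config_borel \<phi> = \<nu>"
    and \<psi>\<phi>: "AE x in \<mu>. \<psi> (\<phi> x) = x"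
    and equi: "\<And>g. AE x in \<mu>. \<phi> (shift g x) = shift g (\<phi> x)"
    using iso unfolding isomorphic_systems_def by blast
  have \<nu>_prob: "config_prob \<nu>"
    using config_prob_distr[OF \<mu>.config_prob_axioms \<phi>] by (simp add: \<nu>)
  interpret \<nu>: config_prob \<nu> by (rule \<nu>_prob)
  have \<phi>\<mu>: "\<phi> \<in> measurable \<mu> config_borel"
    using \<phi> \<mu>.sets_eq by (simp cong: measurable_cong_sets)
  note \<phi>_coord = measurable_compose[OF \<phi> measurable_coordinate]
  note \<psi>_coord = measurable_compose[OF \<psi> measurable_coordinate]
  let ?W = "total_weight TYPE('r)"
  have W: "?W \<ge> 0" by (rule total_weight_nonneg)
  obtain \<delta> where \<delta>: "\<delta> > 0" and ball: "\<forall>V :: 'v set. \<forall>y :: 'v \<Rightarrow> 'a. finite V \<longrightarrow>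
      real (card {x \<in> V \<rightarrow>\<^sub>E UNIV. real (card {v \<in> V. x v \<noteq> y v}) \<le> \<delta> * real (card V)})
        \<le> exp (\<eta> * real (card V))"
    using hamming_ball_card_le[OF \<eta>] by (elim exE conjE)

  \<comment> \<open>The code \<open>g\<close> for the inverse comes first: the error allowed to \<open>f\<close> depends on the number of
    coordinates that \<open>g\<close> reads.\<close>
  have \<delta>4: "\<delta> / 4 > 0" using \<delta> by simp
  obtain G g where G: "finite G" "determined_by G g"
    and g_err: "measure \<nu> {y. g y \<noteq> \<psi> y \<one>\<^bsub>FG\<^esub>} < \<delta> / 4"
    using \<nu>.approximate_by_block_code[OF \<psi>_coord \<delta>4] by blast
  define \<kappa> where "\<kappa> = min (\<delta> / (4 * (real (card G) + 1))) (\<epsilon>' / (2 * (?W + 1)))"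
  have \<kappa>: "\<kappa> > 0" using \<delta> \<epsilon>' W by (auto simp: \<kappa>_def)
  have cancel: "a / (k * c) * c = a / k" if "c > 0" for a k c :: real using that by simp
  have "\<kappa> * (real (card G) + 1) \<le> \<delta> / (4 * (real (card G) + 1)) * (real (card G) + 1)"
    by (intro mult_right_mono) (auto simp: \<kappa>_def)
  also have "\<dots> = \<delta> / 4" by (rule cancel) linarith
  finally have \<kappa>G: "real (card G) * \<kappa> \<le> \<delta> / 4" using \<kappa> by (simp add: algebra_simps)
  have "\<kappa> * (?W + 1) \<le> \<epsilon>' / (2 * (?W + 1)) * (?W + 1)"
    using W by (intro mult_right_mono) (auto simp: \<kappa>_def)
  also have "\<dots> = \<epsilon>' / 2" by (rule cancel) (use W in linarith)
  finally have \<kappa>W: "\<kappa> * ?W \<le> \<epsilon>' / 2" using \<kappa> by (simp add: algebra_simps)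
  obtain F f where F: "finite F" "determined_by F f"
    and f_err: "measure \<mu> {x. f x \<noteq> \<phi> x \<one>\<^bsub>FG\<^esub>} < \<kappa>"
    using \<mu>.approximate_by_block_code[OF \<phi>_coord \<kappa>] by blast
  note fm = measurable_determined_by[OF F(2,1)] and gm = measurable_determined_by[OF G(2,1)]
  have code_err: "measure \<mu> {x. code f x h \<noteq> \<phi> x h} \<le> \<kappa>" for h
    using code_error_le[OF \<mu> \<phi> equi fm, of h] f_err by linarith
  have code_\<nu>: "transport_dist (distr \<mu> config_borel (code f)) \<nu> \<le> \<epsilon>' / 2"
    using \<mu>.transport_dist_distr_le[OF measurable_code[OF fm] \<phi> code_err] \<kappa>W by (simp add: \<nu>)

  \<comment> \<open>The local event that \<open>g\<close> fails to recover the symbol at the identity from the image.\<close>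
  define Q where "Q z \<longleftrightarrow> g (code f z) \<noteq> z \<one>\<^bsub>FG\<^esub>" for z
  define E where "E = insert \<one>\<^bsub>FG\<^esub> ((\<lambda>(k, h). k \<otimes>\<^bsub>FG\<^esub> h) ` (F \<times> G))"
  have finE: "finite E" using F G by (simp add: E_def)
  have QE: "determined_by E Q"
    unfolding determined_by_def
  proof (intro allI impI)
    fix x y :: "('r, 'a) config" assume xy: "\<forall>g\<in>E. x g = y g"
    have "code f x h = code f y h" if "h \<in> G" for h
      unfolding code_def using that xy
      by (intro determined_byD[OF F(2)]) (auto simp: shift_def E_def)
    then have "g (code f x) = g (code f y)" by (intro determined_byD[OF G(2)])
    moreover have "x \<one>\<^bsub>FG\<^esub> = y \<one>\<^bsub>FG\<^esub>" using xy by (simp add: E_def)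
    ultimately show "Q x = Q y" by (simp add: Q_def)
  qed
  have \<mu>Q: "measure \<mu> {z. Q z} \<le> \<delta> / 2"
  proof -
    let ?A = "\<Union>h\<in>G. {x. code f x h \<noteq> \<phi> x h}"
    let ?B = "\<phi> -` {y. g y \<noteq> \<psi> y \<one>\<^bsub>FG\<^esub>} \<inter> space \<mu>"
    have code_sets: "{x. code f x h \<noteq> \<phi> x h} \<in> sets \<mu>" for h
      by (intro \<mu>.sets_neq \<phi>_coord measurable_compose[OF measurable_code[OF fm] measurable_coordinate])
    then have A: "?A \<in> sets \<mu>" using G by auto
    have Bs: "{y. g y \<noteq> \<psi> y \<one>\<^bsub>FG\<^esub>} \<in> sets \<nu>" by (intro \<nu>.sets_neq gm \<psi>_coord)
    then have B: "?B \<in> sets \<mu>" by (intro measurable_sets[OF \<phi>\<mu>]) (simp add: \<nu>.sets_eq)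
    have "AE z in \<mu>. z \<in> {z. Q z} \<longrightarrow> z \<in> ?A \<union> ?B"
      using \<psi>\<phi>
    proof eventually_elim
      case (elim z)
      have "g (code f z) = g (\<phi> z)" if "z \<notin> ?A"
        by (rule determined_byD[OF G(2)]) (use that in auto)
      then show ?case using elim by (auto simp: Q_def \<mu>.space_eq)
    qed
    then have "measure \<mu> {z. Q z} \<le> measure \<mu> (?A \<union> ?B)"
      using A B by (intro \<mu>.finite_measure_mono_AE) auto
    also have "\<dots> \<le> measure \<mu> ?A + measure \<mu> ?B" using A B by (rule measure_Un_le)
    also have "measure \<mu> ?A \<le> (\<Sum>h\<in>G. measure \<mu> {x. code f x h \<noteq> \<phi> x h})"
      using G code_sets by (intro \<mu>.finite_measure_subadditive_finite) auto
    also have "\<dots> \<le> (\<Sum>h\<in>G. \<kappa>)" by (intro sum_mono code_err)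
    also have "\<dots> \<le> \<delta> / 4" using \<kappa>G by simp
    also have "measure \<mu> ?B = measure \<nu> {y. g y \<noteq> \<psi> y \<one>\<^bsub>FG\<^esub>}"
      unfolding \<nu>[symmetric] using Bs \<nu>.sets_eq by (intro measure_distr[symmetric] \<phi>\<mu>) auto
    finally show ?thesis using g_err by linarith
  qed

  let ?LF = "window_constant F" and ?LE = "window_constant E"
  define \<epsilon> where "\<epsilon> = min (\<epsilon>' / (2 * ?LF)) (\<delta> / (2 * ?LE))"
  have \<epsilon>: "\<epsilon> > 0" using \<epsilon>' \<delta> by (auto simp: \<epsilon>_def)
  have "real (card (good_models V \<sigma> \<mu> \<epsilon>)) \<le> exp (\<eta> * real (card V)) * real (card (good_models V \<sigma> \<nu> \<epsilon>'))"
    if V: "finite V" "V \<noteq> {}" and \<sigma>: "\<sigma> \<in> perm_homs V" for V :: "'v set" and \<sigma>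
  proof (rule card_le_fibres[where f = "apply_code V \<sigma> f"])
    let ?n = "real (card V)"
    have n: "?n > 0" using V by (simp add: card_gt_0_iff)
    show "finite (good_models V \<sigma> \<mu> \<epsilon>)" "finite (good_models V \<sigma> \<nu> \<epsilon>')"
      using V by (simp_all add: finite_good_models)
    show "apply_code V \<sigma> f ` good_models V \<sigma> \<mu> \<epsilon> \<subseteq> good_models V \<sigma> \<nu> \<epsilon>'"
    proof safe
      fix x assume "x \<in> good_models V \<sigma> \<mu> \<epsilon>"
      then have "transport_dist (empirical_distribution V \<sigma> x) \<mu> < \<epsilon>' / (2 * ?LF)"
        by (simp add: good_models_def \<epsilon>_def)
      then have "?LF * transport_dist (empirical_distribution V \<sigma> x) \<mu> < ?LF * (\<epsilon>' / (2 * ?LF))"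
        by (intro mult_strict_left_mono) auto
      also have "\<dots> = \<epsilon>' / 2" using window_constant_pos[of F] by (simp add: less_imp_neq[symmetric])
      finally have "transport_dist (empirical_distribution V \<sigma> (apply_code V \<sigma> f x)) \<nu> < \<epsilon>'"
        using transport_dist_apply_code_le[OF V \<sigma> \<mu>.config_prob_axioms \<nu>_prob F(2,1), of x] code_\<nu> by linarith
      then show "apply_code V \<sigma> f x \<in> good_models V \<sigma> \<nu> \<epsilon>'"
        by (auto simp: good_models_def apply_code_def)
    qed
    fix y assume "y \<in> good_models V \<sigma> \<nu> \<epsilon>'"
    let ?y = "apply_code V \<sigma> g y"
    have "real (card {v \<in> V. x v \<noteq> ?y v}) \<le> \<delta> * ?n"
      if x: "x \<in> good_models V \<sigma> \<mu> \<epsilon>" and y: "apply_code V \<sigma> f x = y" for x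
    proof -
      have Qv: "Q (pullback_name \<sigma> x v) \<longleftrightarrow> x v \<noteq> ?y v" if v: "v \<in> V" for v
        using v pullback_apply_code[OF \<sigma> v, of f x] perm_homs_one[OF \<sigma> v]
        by (auto simp: Q_def y[symmetric] apply_code_def[of V \<sigma> g] pullback_name_def[of \<sigma> x v])
      have lip: "config_lipschitz ?LE (\<lambda>z. of_bool (Q z))"
        by (rule config_lipschitz_determined_event[OF QE finE])
      have Qm: "(\<lambda>z. of_bool (Q z) :: real) \<in> borel_measurable config_borel"
        by (rule borel_measurable_config_lipschitz[OF lip]) simp
      have "real (card {v \<in> V. x v \<noteq> ?y v}) / ?n = (\<Sum>v\<in>V. of_bool (Q (pullback_name \<sigma> x v))) / ?n"
        using V by (simp add: Qv of_bool_def sum.If_cases Int_def cong: sum.cong)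
      also have "\<dots> = integral\<^sup>L (empirical_distribution V \<sigma> x) (\<lambda>z. of_bool (Q z))"
        by (rule integral_empirical_distribution[OF V Qm, symmetric])
      also have "\<dots> \<le> integral\<^sup>L \<mu> (\<lambda>z. of_bool (Q z)) + ?LE * transport_dist (empirical_distribution V \<sigma> x) \<mu>"
        using integral_diff_le_transport_dist[OF config_prob_empirical[OF V] \<mu>.config_prob_axioms lip window_constant_pos, of \<sigma> x]
        by linarith
      also have "integral\<^sup>L \<mu> (\<lambda>z. of_bool (Q z)) = measure \<mu> {z. Q z}"
      proof -
        have "(\<lambda>z. of_bool (Q z) :: real) = indicator {z. Q z}" by (auto simp: indicator_def)
        then show ?thesis by (simp add: \<mu>.space_eq)
      qed
      also have "?LE * transport_dist (empirical_distribution V \<sigma> x) \<mu> \<le> ?LE * (\<delta> / (2 * ?LE))"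
        using x by (intro mult_left_mono) (auto simp: good_models_def \<epsilon>_def)
      also have "\<dots> = \<delta> / 2" using window_constant_pos[of E] by (simp add: less_imp_neq[symmetric])
      finally have "real (card {v \<in> V. x v \<noteq> ?y v}) / ?n \<le> \<delta>" using \<mu>Q by linarith
      then show ?thesis using n by (simp add: pos_divide_le_eq)
    qed
    then have "{x \<in> good_models V \<sigma> \<mu> \<epsilon>. apply_code V \<sigma> f x = y}
        \<subseteq> {x \<in> V \<rightarrow>\<^sub>E UNIV. real (card {v \<in> V. x v \<noteq> ?y v}) \<le> \<delta> * ?n}"
      by (auto simp: good_models_def)
    moreover have "finite {x \<in> V \<rightarrow>\<^sub>E UNIV. real (card {v \<in> V. x v \<noteq> ?y v}) \<le> \<delta> * ?n}"
      by (rule finite_subset[of _ "V \<rightarrow>\<^sub>E UNIV"]) (use V in \<open>auto intro!: finite_PiE\<close>)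
    ultimately have "card {x \<in> good_models V \<sigma> \<mu> \<epsilon>. apply_code V \<sigma> f x = y}
        \<le> card {x \<in> V \<rightarrow>\<^sub>E UNIV. real (card {v \<in> V. x v \<noteq> ?y v}) \<le> \<delta> * ?n}"
      by (intro card_mono)
    then show "real (card {x \<in> good_models V \<sigma> \<mu> \<epsilon>. apply_code V \<sigma> f x = y}) \<le> exp (\<eta> * ?n)"
      using ball[rule_format, OF V(1), of ?y] by linarith
  qed simp
  then show ?thesis using \<epsilon> by blast
qed

section \<open>Comparing the typical entropies\<close>

lemma ereal_le_elog_iff:
  assumes "n > 0"
  shows "ereal h \<le> ereal (1 / real n) * elog (real k) \<longleftrightarrow> k > 0 \<and> h * real n \<le> ln (real k)"
proof (cases "k = 0")
  case True
  then show ?thesis using assms by (simp add: elog_def)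
next
  case False
  then show ?thesis using assms by (simp add: elog_def field_simps)
qed

lemma rho_eq:
  assumes "finite V" "V \<noteq> {}"
  shows "rho V \<mu> \<sigma> h = Inf {\<epsilon>. \<epsilon> > 0 \<and> card (good_models V \<sigma> \<mu> \<epsilon>) > 0 \<and>
    h * real (card V) \<le> ln (real (card (good_models V \<sigma> \<mu> \<epsilon>)))}"
proof -
  have "card V > 0" using assms by (simp add: card_gt_0_iff)
  then show ?thesis by (simp only: rho_def ereal_le_elog_iff)
qed

lemma good_models_large:
  fixes \<mu> :: "('r::finite, 'a::finite) config measure"
  assumes V: "finite V" "V \<noteq> {}" and \<mu>: "config_prob \<mu>"
  shows "good_models V \<sigma> \<mu> (total_weight TYPE('r) + 1) = V \<rightarrow>\<^sub>E UNIV"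
proof -
  have "transport_dist (empirical_distribution V \<sigma> x) \<mu> < total_weight TYPE('r) + 1" for x
    by (rule le_less_trans[OF transport_dist_le_total[OF config_prob_empirical[OF V] \<mu>]]) simp
  then show ?thesis by (auto simp: good_models_def)
qed

text \<open>For \<open>h\<close> at most the logarithm of the alphabet size the infimum ranges over a nonempty set:
  at a radius above the diameter every labelling is a good model.\<close>

lemma rho_bounds:
  fixes \<mu> :: "('r::finite, 'a::finite) config measure" and V :: "'v set"
  assumes V: "finite V" "V \<noteq> {}" and \<mu>: "config_prob \<mu>" and h: "h \<le> ln (real CARD('a))"
  shows rho_set_nonempty: "{\<epsilon>. \<epsilon> > 0 \<and> card (good_models V \<sigma> \<mu> \<epsilon>) > 0 \<and>
      h * real (card V) \<le> ln (real (card (good_models V \<sigma> \<mu> \<epsilon>)))} \<noteq> {}" (is "?S \<noteq> {}")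
    and rho_nonneg: "0 \<le> rho V \<mu> \<sigma> h" and rho_le: "rho V \<mu> \<sigma> h \<le> total_weight TYPE('r) + 1"
proof -
  let ?D = "total_weight TYPE('r) + 1"
  have card: "card (good_models V \<sigma> \<mu> ?D) = CARD('a) ^ card V"
    unfolding good_models_large[OF V \<mu>] using V by (simp add: card_PiE)
  have "ln (real (CARD('a) ^ card V)) = ln (real CARD('a)) * real (card V)"
    by (simp add: ln_realpow)
  moreover have "h * real (card V) \<le> ln (real CARD('a)) * real (card V)"
    using h by (intro mult_right_mono) auto
  ultimately have D: "?D \<in> ?S" using total_weight_nonneg[where 'r = 'r] by (simp add: card)
  then show ne: "?S \<noteq> {}" by blast
  show "0 \<le> rho V \<mu> \<sigma> h" unfolding rho_eq[OF V] by (rule cInf_greatest[OF ne]) auto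
  show "rho V \<mu> \<sigma> h \<le> ?D" unfolding rho_eq[OF V]
    by (rule cInf_lower[OF D]) (auto intro!: bdd_belowI[of _ 0])
qed

text \<open>If \<open>rho\<close> of \<open>\<mu>\<close> is below the radius that the transfer of models needs, then \<open>rho\<close> of \<open>\<nu>\<close> is at
  most \<open>\<epsilon>'\<close>; otherwise a large multiple of it dominates the diameter.  The linear form of the
  bound survives taking expectations.\<close>

lemma rho_transfer:
  fixes \<mu> \<nu> :: "('r::finite, 'a::finite) config measure"
  assumes \<mu>: "\<mu> \<in> shift_invariant_probs" and \<nu>: "\<nu> \<in> shift_invariant_probs"
    and iso: "isomorphic_systems \<mu> \<nu>"
    and h: "h \<in> {0..ln (real CARD('a))}" and \<eta>: "\<eta> > 0" and \<epsilon>': "\<epsilon>' > 0"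
  shows "\<exists>K\<ge>0. \<forall>V :: 'v set. \<forall>\<sigma>. finite V \<and> V \<noteq> {} \<and> \<sigma> \<in> perm_homs V \<longrightarrow>
    rho V \<nu> \<sigma> (max 0 (h - \<eta>)) \<le> \<epsilon>' + K * rho V \<mu> \<sigma> h"
proof -
  let ?D = "total_weight TYPE('r) + 1"
  let ?h' = "max 0 (h - \<eta>)"
  note \<mu>_prob = shift_invariant_probsD(1)[OF \<mu>] and \<nu>_prob = shift_invariant_probsD(1)[OF \<nu>]
  have D: "?D > 0" using total_weight_nonneg[where 'r = 'r] by simp
  have hle: "h \<le> ln (real CARD('a))" and h'le: "?h' \<le> ln (real CARD('a))" using h \<eta> by auto
  obtain \<epsilon> where \<epsilon>: "\<epsilon> > 0" and transfer: "\<And>(V :: 'v set) \<sigma>.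
      finite V \<Longrightarrow> V \<noteq> {} \<Longrightarrow> \<sigma> \<in> perm_homs V \<Longrightarrow> real (card (good_models V \<sigma> \<mu> \<epsilon>))
        \<le> exp (\<eta> * real (card V)) * real (card (good_models V \<sigma> \<nu> \<epsilon>'))"
    using card_good_models_transfer[OF \<mu> iso \<eta> \<epsilon>', where 'v = 'v] by blast
  have "rho V \<nu> \<sigma> ?h' \<le> \<epsilon>' + ?D / \<epsilon> * rho V \<mu> \<sigma> h"
    if V: "finite V" "V \<noteq> {}" and \<sigma>: "\<sigma> \<in> perm_homs V" for V :: "'v set" and \<sigma>
  proof (cases "rho V \<mu> \<sigma> h < \<epsilon>")
    case True
    let ?n = "real (card V)" and ?M = "card (good_models V \<sigma> \<mu> \<epsilon>)"
      and ?N = "card (good_models V \<sigma> \<nu> \<epsilon>')"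
    obtain \<epsilon>\<^sub>0 where \<epsilon>\<^sub>0: "\<epsilon>\<^sub>0 < \<epsilon>" "card (good_models V \<sigma> \<mu> \<epsilon>\<^sub>0) > 0"
      "h * ?n \<le> ln (real (card (good_models V \<sigma> \<mu> \<epsilon>\<^sub>0)))"
      using cInf_lessD[OF rho_set_nonempty[OF V \<mu>_prob hle] True[unfolded rho_eq[OF V]]] by blast
    have le: "card (good_models V \<sigma> \<mu> \<epsilon>\<^sub>0) \<le> ?M"
      using \<epsilon>\<^sub>0(1) V by (intro card_mono finite_good_models good_models_mono) auto
    then have M: "?M > 0" using \<epsilon>\<^sub>0(2) by linarith
    have hM: "h * ?n \<le> ln (real ?M)"
      using \<epsilon>\<^sub>0(2,3) le by (meson ln_mono of_nat_0_less_iff of_nat_mono order_trans)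
    have MN: "real ?M \<le> exp (\<eta> * ?n) * real ?N" by (rule transfer[OF V \<sigma>])
    have N: "?N > 0" using MN M by (cases "?N = 0") auto
    have "ln (real ?M) \<le> ln (exp (\<eta> * ?n) * real ?N)" using MN M N by (intro ln_mono) auto
    also have "\<dots> = \<eta> * ?n + ln (real ?N)" using N by (simp add: ln_mult)
    finally have "(h - \<eta>) * ?n \<le> ln (real ?N)" using hM by (simp add: algebra_simps)
    moreover have "0 \<le> ln (real ?N)" using N by simp
    ultimately have "?h' * ?n \<le> ln (real ?N)" by (simp add: max_def)
    then have "rho V \<nu> \<sigma> ?h' \<le> \<epsilon>'"
      unfolding rho_eq[OF V] using N \<epsilon>' by (intro cInf_lower) (auto intro!: bdd_belowI[of _ 0])
    moreover have "0 \<le> ?D / \<epsilon> * rho V \<mu> \<sigma> h"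
      using D \<epsilon> rho_nonneg[OF V \<mu>_prob hle] by (intro mult_nonneg_nonneg) auto
    ultimately show ?thesis by linarith
  next
    case False
    then have "?D / \<epsilon> * \<epsilon> \<le> ?D / \<epsilon> * rho V \<mu> \<sigma> h" using D \<epsilon> by (intro mult_left_mono) auto
    then show ?thesis using rho_le[OF V \<nu>_prob h'le, of \<sigma>] \<epsilon> \<epsilon>' by simp
  qed
  then show ?thesis using D \<epsilon> by (intro exI[of _ "?D / \<epsilon>"]) auto
qed

lemma integrable_rho:
  fixes \<mu> :: "('r::finite, 'a::finite) config measure"
  assumes V: "finite V" "V \<noteq> {}" and P: "set_pmf P \<subseteq> perm_homs V" and \<mu>: "config_prob \<mu>"
    and h: "h \<le> ln (real CARD('a))"
  shows "integrable (measure_pmf P) (\<lambda>\<sigma>. rho V \<mu> \<sigma> h)"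
  using rho_nonneg[OF V \<mu> h] rho_le[OF V \<mu> h]
  by (intro measure_pmf.integrable_const_bound[where B = "total_weight TYPE('r) + 1"]) auto

lemma expectation_rho_transfer:
  fixes \<mu> \<nu> :: "('r::finite, 'a::finite) config measure"
    and V :: "nat \<Rightarrow> 'v set" and P :: "nat \<Rightarrow> ('r free_group \<Rightarrow> 'v \<Rightarrow> 'v) pmf"
  assumes V: "\<And>n. finite (V n)" "\<And>n. V n \<noteq> {}" and P: "\<And>n. set_pmf (P n) \<subseteq> perm_homs (V n)"
    and \<mu>: "\<mu> \<in> shift_invariant_probs" and \<nu>: "\<nu> \<in> shift_invariant_probs"
    and iso: "isomorphic_systems \<mu> \<nu>"
    and h: "h \<in> {0..ln (real CARD('a))}" and \<eta>: "\<eta> > 0" and \<epsilon>': "\<epsilon>' > 0"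
  shows "\<exists>K\<ge>0. \<forall>n. measure_pmf.expectation (P n) (\<lambda>\<sigma>. rho (V n) \<nu> \<sigma> (max 0 (h - \<eta>)))
    \<le> \<epsilon>' + K * measure_pmf.expectation (P n) (\<lambda>\<sigma>. rho (V n) \<mu> \<sigma> h)"
proof -
  obtain K where K: "K \<ge> 0" and le: "\<And>(V :: 'v set) \<sigma>. finite V \<Longrightarrow> V \<noteq> {} \<Longrightarrow> \<sigma> \<in> perm_homs V \<Longrightarrow>
      rho V \<nu> \<sigma> (max 0 (h - \<eta>)) \<le> \<epsilon>' + K * rho V \<mu> \<sigma> h"
    using rho_transfer[OF \<mu> \<nu> iso h \<eta> \<epsilon>', where 'v = 'v] by blast
  have hle: "h \<le> ln (real CARD('a))" and h'le: "max 0 (h - \<eta>) \<le> ln (real CARD('a))"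
    using h \<eta> by auto
  have "measure_pmf.expectation (P n) (\<lambda>\<sigma>. rho (V n) \<nu> \<sigma> (max 0 (h - \<eta>)))
      \<le> \<epsilon>' + K * measure_pmf.expectation (P n) (\<lambda>\<sigma>. rho (V n) \<mu> \<sigma> h)" for n
  proof -
    note int\<mu> = integrable_rho[OF V P shift_invariant_probsD(1)[OF \<mu>] hle, of n]
    note int\<nu> = integrable_rho[OF V P shift_invariant_probsD(1)[OF \<nu>] h'le, of n]
    have "measure_pmf.expectation (P n) (\<lambda>\<sigma>. rho (V n) \<nu> \<sigma> (max 0 (h - \<eta>)))
        \<le> measure_pmf.expectation (P n) (\<lambda>\<sigma>. \<epsilon>' + K * rho (V n) \<mu> \<sigma> h)"
      using int\<mu> int\<nu> P by (intro integral_mono_AE AE_pmfI le V) auto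
    also have "\<dots> = \<epsilon>' + K * measure_pmf.expectation (P n) (\<lambda>\<sigma>. rho (V n) \<mu> \<sigma> h)"
      using int\<mu> by simp
    finally show ?thesis .
  qed
  then show ?thesis using K by blast
qed

text \<open>The bound has an additive error \<open>\<epsilon>\<close> that is independent of \<open>R\<close>, so a zero of \<open>R\<close> at \<open>h\<close> forces
  zeros of \<open>R'\<close> at points of \<open>{0..c}\<close> that approach \<open>h\<close> from below.\<close>

lemma Sup_zeros_le:
  fixes R R' :: "real \<Rightarrow> ereal"
  assumes nonneg: "\<And>h. h \<in> {0..c} \<Longrightarrow> 0 \<le> R' h"
    and le: "\<And>h \<eta> \<epsilon>. h \<in> {0..c} \<Longrightarrow> \<eta> > 0 \<Longrightarrow> \<epsilon> > 0 \<Longrightarrow>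
      \<exists>K. R' (max 0 (h - \<eta>)) \<le> ereal \<epsilon> + ereal K * R h"
  shows "Sup {ereal h | h. h \<in> {0..c} \<and> R h = 0} \<le> Sup {ereal h | h. h \<in> {0..c} \<and> R' h = 0}"
proof (rule Sup_least, clarify)
  fix h assume h: "h \<in> {0..c}" and R: "R h = 0"
  show "ereal h \<le> Sup {ereal h | h. h \<in> {0..c} \<and> R' h = 0}" (is "_ \<le> ?s")
  proof (rule ereal_le_epsilon2)
    fix \<eta> :: real assume \<eta>: "\<eta> > 0"
    let ?h' = "max 0 (h - \<eta>)"
    have h': "?h' \<in> {0..c}" using h \<eta> by auto
    have "R' ?h' \<le> 0 + ereal \<epsilon>" if "\<epsilon> > 0" for \<epsilon>
      using le[OF h \<eta> that] R by auto
    then have "R' ?h' \<le> 0" by (rule ereal_le_epsilon2)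
    then have "R' ?h' = 0" using nonneg[OF h'] by (rule antisym)
    then have "ereal ?h' \<le> ?s" using h' by (intro Sup_upper) blast
    moreover have "ereal h \<le> ereal ?h' + ereal \<eta>"
    proof -
      have "h \<le> ?h' + \<eta>" by (simp add: max_def)
      then show ?thesis by (metis ereal_less_eq(3) plus_ereal.simps(1))
    qed
    ultimately show "ereal h \<le> ?s + ereal \<eta>" by (meson add_right_mono order_trans)
  qed
qed

lemma typical_entropies_le:
  fixes V :: "nat \<Rightarrow> 'v set"
    and P :: "nat \<Rightarrow> ('r::finite free_group \<Rightarrow> 'v \<Rightarrow> 'v) pmf"
    and \<mu> \<nu> :: "('r, 'a::finite) config measure"
  assumes V: "\<And>n. finite (V n)" "\<And>n. V n \<noteq> {}" and P: "\<And>n. set_pmf (P n) \<subseteq> perm_homs (V n)"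
    and \<mu>: "\<mu> \<in> shift_invariant_probs" and \<nu>: "\<nu> \<in> shift_invariant_probs"
    and iso: "isomorphic_systems \<mu> \<nu>"
  shows h_sharp_le: "h_sharp V P \<mu> \<le> h_sharp V P \<nu>" and h_flat_le: "h_flat V P \<mu> \<le> h_flat V P \<nu>"
proof -
  let ?c = "ln (real CARD('a))"
  have E_nonneg: "0 \<le> ereal (measure_pmf.expectation (P n) (\<lambda>\<sigma>. rho (V n) \<nu> \<sigma> h))"
    if "h \<in> {0..?c}" for h n
    using rho_nonneg[OF V shift_invariant_probsD(1)[OF \<nu>]] that by (auto intro!: integral_nonneg)
  have upper_nonneg: "0 \<le> rho_upper V P \<nu> h" and lower_nonneg: "0 \<le> rho_lower V P \<nu> h"
    if "h \<in> {0..?c}" for h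
    unfolding rho_upper_def rho_lower_def using E_nonneg[OF that]
    by (auto intro!: le_Limsup Liminf_bounded)
  have "\<exists>K. rho_upper V P \<nu> (max 0 (h - \<eta>)) \<le> ereal \<epsilon> + ereal K * rho_upper V P \<mu> h \<and>
      rho_lower V P \<nu> (max 0 (h - \<eta>)) \<le> ereal \<epsilon> + ereal K * rho_lower V P \<mu> h"
    if h: "h \<in> {0..?c}" and \<eta>: "\<eta> > 0" and \<epsilon>: "\<epsilon> > 0" for h \<eta> \<epsilon>
  proof -
    obtain K where K: "K \<ge> 0" and le: "\<And>n.
        measure_pmf.expectation (P n) (\<lambda>\<sigma>. rho (V n) \<nu> \<sigma> (max 0 (h - \<eta>)))
          \<le> \<epsilon> + K * measure_pmf.expectation (P n) (\<lambda>\<sigma>. rho (V n) \<mu> \<sigma> h)"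
      using expectation_rho_transfer[where V = V and P = P, OF V P \<mu> \<nu> iso h \<eta> \<epsilon>] by blast
    let ?e = "\<lambda>n. ereal (measure_pmf.expectation (P n) (\<lambda>\<sigma>. rho (V n) \<mu> \<sigma> h))"
    have le': "ereal (measure_pmf.expectation (P n) (\<lambda>\<sigma>. rho (V n) \<nu> \<sigma> (max 0 (h - \<eta>))))
        \<le> ereal \<epsilon> + ereal K * ?e n" for n
      using le[of n] by simp
    have "rho_upper V P \<nu> (max 0 (h - \<eta>)) \<le> limsup (\<lambda>n. ereal \<epsilon> + ereal K * ?e n)"
      unfolding rho_upper_def by (intro Limsup_mono always_eventually allI le')
    also have "\<dots> = ereal \<epsilon> + ereal K * limsup ?e"
      using K by (subst Limsup_add_ereal_left, simp, simp, subst Limsup_ereal_mult_left) simp_all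
    finally have upper: "rho_upper V P \<nu> (max 0 (h - \<eta>)) \<le> ereal \<epsilon> + ereal K * rho_upper V P \<mu> h"
      by (simp only: rho_upper_def)
    have "rho_lower V P \<nu> (max 0 (h - \<eta>)) \<le> liminf (\<lambda>n. ereal \<epsilon> + ereal K * ?e n)"
      unfolding rho_lower_def by (intro Liminf_mono always_eventually allI le')
    also have "\<dots> = ereal \<epsilon> + ereal K * liminf ?e"
      using K by (subst Liminf_add_ereal_left, simp, simp, subst Liminf_ereal_mult_left) simp_all
    finally have lower: "rho_lower V P \<nu> (max 0 (h - \<eta>)) \<le> ereal \<epsilon> + ereal K * rho_lower V P \<mu> h"
      by (simp only: rho_lower_def)
    show ?thesis using upper lower by blast
  qed
  note transfer = this
  show "h_sharp V P \<mu> \<le> h_sharp V P \<nu>"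
    unfolding h_sharp_def using transfer by (intro Sup_zeros_le[OF lower_nonneg]) blast+
  show "h_flat V P \<mu> \<le> h_flat V P \<nu>"
    unfolding h_flat_def using transfer by (intro Sup_zeros_le[OF upper_nonneg]) blast+
qed

theorem corollary1p2:
  fixes V :: "nat \<Rightarrow> 'v set"
    and P :: "nat \<Rightarrow> ('r::finite free_group \<Rightarrow> 'v \<Rightarrow> 'v) pmf"
    and \<mu> \<nu> :: "('r, 'a::finite) config measure"
  assumes "random_sofic_approximation V P"
    and "exponentially_concentrated V P"
    and "\<mu> \<in> shift_invariant_probs"
    and "\<nu> \<in> shift_invariant_probs"
    and "isomorphic_systems \<mu> \<nu>"
  shows "h_sharp V P \<mu> = h_sharp V P \<nu> \<and> h_flat V P \<mu> = h_flat V P \<nu>"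
proof -
  have V: "\<And>n. finite (V n)" "\<And>n. V n \<noteq> {}" and P: "\<And>n. set_pmf (P n) \<subseteq> perm_homs (V n)"
    using assms(1) by (auto simp: random_sofic_approximation_def)
  have iso': "isomorphic_systems \<nu> \<mu>" by (rule isomorphic_systems_sym[OF assms(3,5)])
  show ?thesis
    using typical_entropies_le[OF V P assms(3,4,5)] typical_entropies_le[OF V P assms(4,3) iso']
    by (intro conjI antisym)
qed

end
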